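(* For $n\in\mathbb N$, and for any $\delta>0$, $$\mathbb E_n[\text{Area enclosed by a single traversal}]=\sum_{m=1}^n m\,\mathbb E_m[\tau_f]=\frac{\pi n^2}{4}+O\bigl(n^{(3/2)+\delta}\bigr),$$ where the first equality is exact for every $n\in\mathbb N$ and the second is asymptotic as $n\to\infty$.
   Context: $\operatorname{sgn}(x)=-1,0,1$ according as $x<0$, $x=0$, $x>0$. The fast embedding $(A(t),B(t))_{t\ge0}$ of the simple harmonic urn is the continuous-time Markov chain on $\mathbb Z^2\setminus\{(0,0)\}$ which from state $(a,b)$ jumps to $(a-\operatorname{sgn}(b),b)$ at rate $|b|$ and to $(a,b+\operatorname{sgn}(a))$ at rate $|a|$. Its jump chain is the simple harmonic urn process. $\mathbb E_n$ denotes expectation given $A(0)=n$, $B(0)=0$, and $\tau_f=\inf\{t\ge0:A(t)=0\}$. "Area enclosed by a single traversal" is the area of the region of the first quadrant bounded by the two coordinate axes and the lattice path followed by $(A(t),B(t))$ from $(n,0)$ at time $0$ until it hits the positive $y$-axis at time $\tau_f$ (successive positions joined by unit segments). *)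

theory Defs
  imports "HOL-Probability.Probability" "HOL-Library.Landau_Symbols"
begin

text \<open>
  Jump times of a path with values in a discrete space. If the path has no jump after
  \<open>jump_time x k\<close>, then \<open>jump_time x (Suc k)\<close> is the unspecified real \<open>Inf {}\<close>; this is a null
  event for the chains below, whose exit rates are all positive.
\<close>
primrec jump_time :: "(real \<Rightarrow> 's) \<Rightarrow> nat \<Rightarrow> real" where
  "jump_time x 0 = 0"
| "jump_time x (Suc k) = Inf {t. jump_time x k < t \<and> x t \<noteq> x (jump_time x k)}"

definition jump_chain :: "(real \<Rightarrow> 's) \<Rightarrow> nat \<Rightarrow> 's" where
  "jump_chain x k = x (jump_time x k)"

definition holding_time :: "(real \<Rightarrow> 's) \<Rightarrow> nat \<Rightarrow> real" where
  "holding_time x k = jump_time x (Suc k) - jump_time x k"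

definition exit_rate :: "'s set \<Rightarrow> ('s \<Rightarrow> 's \<Rightarrow> real) \<Rightarrow> 's \<Rightarrow> real" where
  "exit_rate E q i = (\<Sum>\<^sub>\<infinity>j\<in>E - {i}. q i j)"

definition jump_prob :: "'s set \<Rightarrow> ('s \<Rightarrow> 's \<Rightarrow> real) \<Rightarrow> 's \<Rightarrow> 's \<Rightarrow> real" where
  "jump_prob E q i j = (if i = j then 0 else q i j / exit_rate E q i)"

text \<open>
  A right-continuous process \<open>X\<close> is a continuous-time Markov chain on the countable set \<open>E\<close>, started
  at \<open>x\<close>, with jump rates \<open>q i j\<close> (\<open>i \<noteq> j\<close>), if its jump chain is the discrete-time Markov chain with
  transition probabilities \<open>jump_prob E q\<close> and, given the jump chain \<open>i\<^sub>0, i\<^sub>1, \<dots>\<close>, the holding times are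
  independent and exponential with parameters \<open>exit_rate E q i\<^sub>0, exit_rate E q i\<^sub>1, \<dots>\<close>.
  The last condition states this as the joint law of the first \<open>k + 1\<close> states and holding
  times. It is meant for chains without absorbing states.
\<close>
definition markov_jump_process ::
  "'w measure \<Rightarrow> 's set \<Rightarrow> ('s \<Rightarrow> 's \<Rightarrow> real) \<Rightarrow> 's \<Rightarrow> (real \<Rightarrow> 'w \<Rightarrow> 's) \<Rightarrow> bool" where
  "markov_jump_process M E q x X \<longleftrightarrow>
     prob_space M \<and>
     (\<forall>t\<ge>0. X t \<in> M \<rightarrow>\<^sub>M count_space E) \<and>
     (\<forall>\<omega>\<in>space M. \<forall>t\<ge>0. \<forall>\<^sub>F s in at_right t. X s \<omega> = X t \<omega>) \<and>
     (\<forall>k. (\<lambda>\<omega>. jump_chain (\<lambda>t. X t \<omega>) k) \<in> M \<rightarrow>\<^sub>M count_space E) \<and>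
     (\<forall>k. (\<lambda>\<omega>. holding_time (\<lambda>t. X t \<omega>) k) \<in> borel_measurable M) \<and>
     (\<forall>k i s. (\<forall>j\<le>k. i j \<in> E) \<longrightarrow> (\<forall>j\<le>k. 0 \<le> s j) \<longrightarrow>
        measure M {\<omega> \<in> space M. \<forall>j\<le>k.
            jump_chain (\<lambda>t. X t \<omega>) j = i j \<and> s j < holding_time (\<lambda>t. X t \<omega>) j}
        = (if i 0 = x then 1 else 0)
          * (\<Prod>j<k. jump_prob E q (i j) (i (Suc j)))
          * (\<Prod>j\<le>k. exp (- exit_rate E q (i j) * s j)))"

definition urn_rate :: "int \<times> int \<Rightarrow> int \<times> int \<Rightarrow> real" where
  "urn_rate = (\<lambda>(a, b) z.
     (if z = (a - sgn b, b) then real_of_int \<bar>b\<bar> else 0) +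
     (if z = (a, b + sgn a) then real_of_int \<bar>a\<bar> else 0))"

definition fast_embedding ::
  "'w measure \<Rightarrow> int \<times> int \<Rightarrow> (real \<Rightarrow> 'w \<Rightarrow> int) \<Rightarrow> (real \<Rightarrow> 'w \<Rightarrow> int) \<Rightarrow> bool" where
  "fast_embedding M z A B \<longleftrightarrow>
     markov_jump_process M (- {(0, 0)}) urn_rate z (\<lambda>t \<omega>. (A t \<omega>, B t \<omega>))"

text \<open>The value is \<open>\<infinity>\<close> if the path never hits the vertical axis.\<close>
definition traversal_time :: "(real \<Rightarrow> int \<times> int) \<Rightarrow> ennreal" where
  "traversal_time x = Inf (ennreal ` {t. 0 \<le> t \<and> fst (x t) = 0})"

definition lattice_point :: "int \<times> int \<Rightarrow> real \<times> real" where
  "lattice_point = map_prod real_of_int real_of_int"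

definition traversal_path :: "(real \<Rightarrow> int \<times> int) \<Rightarrow> (real \<times> real) set" where
  "traversal_path x =
     (\<Union>k\<in>{k. ennreal (jump_time x k) < traversal_time x}.
        closed_segment (lattice_point (jump_chain x k)) (lattice_point (jump_chain x (Suc k))))"

definition traversal_region :: "(real \<Rightarrow> int \<times> int) \<Rightarrow> (real \<times> real) set" where
  "traversal_region x =
     {p. 0 < fst p \<and> 0 < snd p} \<inter> inside ({p. fst p = 0 \<or> snd p = 0} \<union> traversal_path x)"

definition traversal_area :: "(real \<Rightarrow> int \<times> int) \<Rightarrow> ennreal" where
  "traversal_area x = emeasure lborel (traversal_region x)"

end

theory Submission imports Defs begin

text \<open>
  Write \<open>L f a b = a (f a (b + 1) - f a b) + b (f (a - 1) b - f a b)\<close> for the generator in the first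
  quadrant. The expected traversal time \<open>F a b\<close> from \<open>(a, b)\<close> satisfies \<open>L F = -1\<close>, and the expected
  remaining area \<open>H a b\<close> satisfies \<open>L H = -a\<^sup>2\<close>, because an upward jump from \<open>(a, b)\<close>, which has
  rate \<open>a\<close>, adds a horizontal strip of area \<open>a\<close>. A telescoping sum shows that
  \<open>\<Sum>m=1..a. m F m b\<close> solves the same equation as \<open>H\<close>, and solutions that vanish at \<open>a = 0\<close> and are
  bounded in \<open>b\<close> for each \<open>a\<close> are unique by a maximum principle. For the asymptotics, \<open>F\<close> is compared
  with the angle \<open>arctan (a/b)\<close>, for which \<open>L\<close> gives \<open>-1 + O(1/(a + b))\<close>. The error is absorbed
  by supersolutions built from \<open>a/(a + b)\<close> and from the harmonic quadratic form
  \<open>a\<^sup>2 + b\<^sup>2 + a - b\<close>, so that \<open>F n 0 = \<pi>/2 + O(1/n)\<close>.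
\<close>

section \<open>The generator and its bounded solutions\<close>

text \<open>A multiple of a/(a + b) alone would absorb an angle error of size 1/s, s = a + b, only
  at the price of a constant error in \<open>F n 0\<close>. With l = 1/n, the inequality 2/s <= l +
  1/(l s^2) splits the error into a constant source of size 1/n and a source of order 1/s^2 with
  weight n. The ratio absorbs the first at cost O(1/n). The radial supersolution absorbs the second,
  and its value at (n, 1) is O(1/n^2), so the weight n still leaves O(1/n). After multiplication by
  m and summation the error is O(n), within the bound claimed.

  Comparisons run over b >= 1 only: there the chance of an upward jump from column a is at most a/(a
  + 1) < 1, which drives the maximum principle, while in row 0 it is 1 and a/b is degenerate. Row 0
  is left by a single forced upward jump and is recovered afterwards.

  The process is given only through the joint law of finitely many states and holding times.
  Expectations are therefore computed over cylinder events by a one-step recursion, and monotone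
  convergence removes the truncation; finiteness of the expected time and area comes out of
  this.\<close>

definition urn_gen :: "(nat \<Rightarrow> nat \<Rightarrow> real) \<Rightarrow> nat \<Rightarrow> nat \<Rightarrow> real" where
  "urn_gen f a b = real a * (f a (Suc b) - f a b) + real b * (f (a - 1) b - f a b)"

lemma urn_gen_diff: "urn_gen (\<lambda>a b. f a b - g a b) a b = urn_gen f a b - urn_gen g a b"
  by (simp add: urn_gen_def algebra_simps)

text \<open>Induction over columns. In column a, the value at b is at most a weighted mean of the
  value above it and of one in the previous column, which is nonpositive. The upward weight is at
  most q = a/(a + 1), so an upper bound C for the column improves to q C, then to q^2 C, and so on
  down to 0. Boundedness excludes solutions such as b! in column 1.\<close>

lemma urn_gen_max_principle:
  assumes zero: "\<And>b. b \<ge> 1 \<Longrightarrow> D 0 b \<le> 0"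
    and gen: "\<And>a b. a \<ge> 1 \<Longrightarrow> b \<ge> 1 \<Longrightarrow> urn_gen D a b \<ge> 0"
    and bdd: "\<And>a. \<exists>C. \<forall>b\<ge>1. D a b \<le> C"
    and b: "b \<ge> 1"
  shows "D a b \<le> 0"
  using b
proof (induction a arbitrary: b)
  case 0
  then show ?case using zero by simp
next
  case (Suc a b)
  define q where "q = real (Suc a) / real (Suc a + 1)"
  have q: "0 \<le> q" "q < 1" by (auto simp: q_def)
  obtain C0 where C0: "\<And>b. b \<ge> 1 \<Longrightarrow> D (Suc a) b \<le> C0" using bdd by blast
  define C where "C = max C0 0"
  have "\<forall>b\<ge>1. D (Suc a) b \<le> q ^ m * C" for m
  proof (induction m)
    case 0
    then show ?case using C0 by (fastforce simp: C_def)
  next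
    case (Suc m)
    show ?case
    proof (intro allI impI)
      fix b :: nat assume b: "b \<ge> 1"
      let ?B = "q ^ m * C"
      have B: "?B \<ge> 0" using q by (auto simp: C_def)
      have "real (Suc a + b) * D (Suc a) b \<le> real (Suc a) * D (Suc a) (Suc b) + real b * D a b"
        using gen[of "Suc a" b] b by (simp add: urn_gen_def algebra_simps)
      also have "\<dots> \<le> real (Suc a) * ?B + 0"
        using Suc Suc.IH \<open>\<And>b. 1 \<le> b \<Longrightarrow> D a b \<le> 0\<close>[OF b]
        by (intro add_mono mult_left_mono mult_nonneg_nonpos) auto
      finally have "D (Suc a) b \<le> (real (Suc a) / real (Suc a + b)) * ?B"
        by (simp add: field_simps)
      also have "\<dots> \<le> q * ?B"
        using b B by (intro mult_right_mono) (auto simp: q_def intro!: divide_left_mono)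
      finally show "D (Suc a) b \<le> q ^ Suc m * C" by simp
    qed
  qed
  moreover have "(\<lambda>m. q ^ m * C) \<longlonglongrightarrow> 0 * C"
    using q by (intro tendsto_mult LIMSEQ_realpow_zero tendsto_const) auto
  ultimately show ?case
    using Suc.prems by (intro LIMSEQ_le_const[of "\<lambda>m. q ^ m * C"]) auto
qed

lemma area_solution_eq_sum_time_solution:
  assumes F0: "\<And>b. F 0 b = 0" and H0: "\<And>b. H 0 b = 0"
    and F: "\<And>a b. a \<ge> 1 \<Longrightarrow> urn_gen F a b = -1"
    and H: "\<And>a b. a \<ge> 1 \<Longrightarrow> urn_gen H a b = - (real a)\<^sup>2"
    and F_bdd: "\<And>a. \<exists>C. \<forall>b\<ge>1. \<bar>F a b\<bar> \<le> C"
    and H_bdd: "\<And>a. \<exists>C. \<forall>b\<ge>1. \<bar>H a b\<bar> \<le> C"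
  shows "H n 0 = (\<Sum>m=1..n. real m * F m 0)"
proof -
  define h where "h = (\<lambda>a b. \<Sum>m=1..a. real m * F m b)"
  \<comment> \<open>The equation at (m, b) reads m (F m (b + 1) - F m b) = b (F m b - F (m - 1) b) -
    1, whose right side telescopes in m.\<close>
  have tele: "(\<Sum>m=1..a. real m * (F m (Suc b) - F m b)) = real b * F a b - real a" for a b
  proof (induction a)
    case 0
    then show ?case by (simp add: F0)
  next
    case (Suc a)
    then show ?case using F[of "Suc a" b] by (simp add: urn_gen_def algebra_simps)
  qed
  \<comment> \<open>The upward difference contributes a b F a b - a^2 and the left difference - a b
    F a b.\<close>
  have h: "urn_gen h a b = - (real a)\<^sup>2" if "a \<ge> 1" for a b
  proof -
    have "h a (Suc b) - h a b = real b * F a b - real a"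
      using tele[where a = a and b = b] by (simp add: h_def sum_subtractf right_diff_distrib)
    moreover have "h (a - 1) b - h a b = - real a * F a b"
      using that by (cases a) (auto simp: h_def algebra_simps)
    ultimately show ?thesis unfolding urn_gen_def by (simp only:) (simp add: algebra_simps power2_eq_square)
  qed
  have h_bdd: "\<exists>C. \<forall>b\<ge>1. \<bar>h a b\<bar> \<le> C" for a
  proof -
    obtain C where C: "\<And>a b. b \<ge> 1 \<Longrightarrow> \<bar>F a b\<bar> \<le> C a" using F_bdd by metis
    have "\<bar>h a b\<bar> \<le> (\<Sum>m=1..a. real m * C m)" if "b \<ge> 1" for b
      unfolding h_def using that C
      by (intro order_trans[OF sum_abs] sum_mono) (auto simp: abs_mult intro!: mult_left_mono)
    then show ?thesis by blast
  qed
  have bdd: "\<exists>C. \<forall>b\<ge>1. \<bar>H a b - h a b\<bar> \<le> C" for a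
  proof -
    obtain C1 C2 where "\<forall>b\<ge>1. \<bar>H a b\<bar> \<le> C1" "\<forall>b\<ge>1. \<bar>h a b\<bar> \<le> C2"
      using H_bdd h_bdd by metis
    then have "\<forall>b\<ge>1. \<bar>H a b - h a b\<bar> \<le> C1 + C2" by (smt (verit))
    then show ?thesis by blast
  qed
  have h0: "h 0 b = 0" for b by (simp add: h_def)
  have bdd1: "\<exists>C. \<forall>b\<ge>1. H a b - h a b \<le> C" and bdd2: "\<exists>C. \<forall>b\<ge>1. h a b - H a b \<le> C" for a
    using bdd[of a] by (metis abs_le_D1, metis abs_le_D1 abs_minus_commute)
  have "H n 1 - h n 1 \<le> 0"
    by (rule urn_gen_max_principle[where D = "\<lambda>a b. H a b - h a b"])
      (use bdd1 in \<open>simp_all add: urn_gen_diff H h H0 h0\<close>)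
  moreover have "h n 1 - H n 1 \<le> 0"
    by (rule urn_gen_max_principle[where D = "\<lambda>a b. h a b - H a b"])
      (use bdd2 in \<open>simp_all add: urn_gen_diff H h H0 h0\<close>)
  ultimately have eq1: "H n 1 = h n 1" by simp
  \<comment> \<open>Row 0 lies outside the comparison. There the left jump has weight 0, so the
    equation at (n, 0) determines both functions from their common value at (n, 1).\<close>
  show ?thesis
  proof (cases "n = 0")
    case False
    then have n: "n \<ge> 1" by simp
    have "real n * H n 0 = real n * (real n + h n 1)"
      using H[OF n, of 0] eq1 by (simp add: urn_gen_def power2_eq_square algebra_simps)
    moreover have "real n * h n 0 = real n * (real n + h n 1)"
      using h[OF n, of 0] by (simp add: urn_gen_def power2_eq_square algebra_simps)
    ultimately show ?thesis using n by (simp add: h_def)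
  qed (simp add: H0)
qed

section \<open>Comparison of the time solution with the angle\<close>

lemma arctan_ge_cubic:
  fixes x :: real
  assumes "0 \<le> x"
  shows "x - x ^ 3 / 3 \<le> arctan x"
proof -
  have "arctan 0 - (0 - 0 ^ 3 / 3) \<le> arctan x - (x - x ^ 3 / 3)"
  proof (rule DERIV_nonneg_imp_nondecreasing[OF assms])
    fix t :: real
    have "((\<lambda>x. arctan x - (x - x ^ 3 / 3)) has_real_derivative (inverse (1 + t\<^sup>2) - (1 - t\<^sup>2))) (at t)"
      by (auto intro!: derivative_eq_intros)
    moreover have "inverse (1 + t\<^sup>2) - (1 - t\<^sup>2) \<ge> 0"
    proof -
      have "(1 - t\<^sup>2) * (1 + t\<^sup>2) \<le> 1" by (simp add: algebra_simps)
      then have "1 - t\<^sup>2 \<le> 1 / (1 + t\<^sup>2)" by (subst pos_le_divide_eq) (auto simp: add_pos_nonneg)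
      then show ?thesis by (simp add: inverse_eq_divide)
    qed
    ultimately show "\<exists>y. ((\<lambda>x. arctan x - (x - x ^ 3 / 3)) has_real_derivative y) (at t) \<and> 0 \<le> y"
      by blast
  qed
  then show ?thesis by simp
qed

text \<open>Both angles lie in [0, pi/2), so their difference stays where tan is injective and no
  multiple of pi enters.\<close>

lemma arctan_diff:
  fixes x y :: real
  assumes "0 \<le> x" "0 \<le> y"
  shows "arctan x - arctan y = arctan ((x - y) / (1 + x * y))"
proof (rule arctan_unique[symmetric])
  have b: "0 \<le> arctan x" "0 \<le> arctan y" "arctan x < pi/2" "arctan y < pi/2"
    using assms arctan_ubound by auto
  show "- (pi / 2) < arctan x - arctan y" "arctan x - arctan y < pi / 2" using b by linarith+
  then have "cos (arctan x - arctan y) \<noteq> 0" using cos_gt_zero_pi[of "arctan x - arctan y"] by simp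
  then show "tan (arctan x - arctan y) = (x - y) / (1 + x * y)"
    by (subst tan_diff) (auto simp: tan_arctan)
qed

text \<open>The fluid limit a' = -b, b' = a rotates at unit speed, and this is the angle left to the
  vertical axis. At b = 0 division by zero gives the value 0 instead of pi/2.\<close>

definition urn_angle :: "nat \<Rightarrow> nat \<Rightarrow> real" where
  "urn_angle a b = arctan (real a / real b)"

text \<open>A unit jump changes the angle by exactly arctan u or arctan v. The linear parts sum to x
  u + y v = 1 + e, where the terms of order N^2 cancel in the numerator of e and leave at most 2/s.
  Replacing arctan by its argument costs a cubic term of at most 3/s.\<close>

lemma urn_gen_angle:
  assumes a: "a \<ge> 1" and b: "b \<ge> 1"
  shows "\<bar>urn_gen urn_angle a b + 1\<bar> \<le> 5 / real (a + b)"
proof -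
  define x y N s where "x = real a" and "y = real b" and "N = x\<^sup>2 + y\<^sup>2" and "s = x + y"
  have x: "x \<ge> 1" and y: "y \<ge> 1" using assms by (auto simp: x_def y_def)
  have N: "N \<ge> 2" "N > 0"
    using one_le_power[OF x, of 2] one_le_power[OF y, of 2] by (auto simp: N_def)
  \<comment> \<open>This is N >= 2 x in disguise; it keeps the denominator of v comparable to
    N.\<close>
  have "0 \<le> ((x - 1)\<^sup>2 + (y\<^sup>2 - 1))" using one_le_power[OF y, of 2] by simp
  then have Nx: "N - x \<ge> N / 2" by (simp add: N_def power2_eq_square field_simps)
  have s: "s \<ge> 2" using x y by (simp add: s_def)
  have "0 \<le> (x - y)\<^sup>2" by simp
  then have Ns: "N \<ge> s\<^sup>2 / 2" and xy: "x * y \<le> N / 2"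
    by (auto simp: N_def s_def power2_eq_square algebra_simps)
  define u v where "u = x / (N + y)" and "v = y / (N - x)"
  have uv: "0 \<le> u" "0 \<le> v" using x y N Nx by (auto simp: u_def v_def)
  have up: "urn_angle a b - urn_angle a (Suc b) = arctan u"
  proof -
    have "(x / y - x / (1 + y)) / (1 + x / y * (x / (1 + y))) = u"
      using x y N by (simp add: u_def N_def divide_simps) (simp add: algebra_simps power2_eq_square)
    then show ?thesis
      unfolding urn_angle_def using x y by (subst arctan_diff) (auto simp: x_def y_def)
  qed
  have left: "urn_angle a b - urn_angle (a - 1) b = arctan v"
  proof -
    have pos: "y\<^sup>2 + x * (x - 1) > 0" using x y by (intro add_pos_nonneg) auto
    then have "(x / y - (x - 1) / y) / (1 + x / y * ((x - 1) / y)) = v"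
      using x y N Nx unfolding v_def N_def
      by (simp add: divide_simps) (simp add: algebra_simps power2_eq_square)
    moreover have "real (a - 1) = x - 1" using a by (simp add: x_def)
    ultimately show ?thesis
      unfolding urn_angle_def using x y by (subst arctan_diff) (auto simp: x_def y_def)
  qed
  have gen: "urn_gen urn_angle a b = - (x * arctan u + y * arctan v)"
  proof -
    have "urn_angle a (Suc b) - urn_angle a b = - arctan u" "urn_angle (a - 1) b - urn_angle a b = - arctan v"
      using up left by auto
    then show ?thesis unfolding urn_gen_def by (simp only:) (simp add: x_def y_def)
  qed
  define e where "e = x * y * (y - x + 1) / ((N + y) * (N - x))"
  have e_eq: "x * u + y * v - 1 = e"
  proof -
    have "x * u + y * v - 1 = (x * x * (N - x) + y * y * (N + y) - (N + y) * (N - x)) / ((N + y) * (N - x))"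
      using x y N Nx by (simp add: u_def v_def divide_simps)
    also have "x * x * (N - x) + y * y * (N + y) - (N + y) * (N - x) = x * y * (y - x + 1)"
      by (simp add: N_def power2_eq_square algebra_simps)
    finally show ?thesis by (simp add: e_def)
  qed
  have e: "\<bar>e\<bar> \<le> 2 / s"
  proof -
    have "\<bar>e\<bar> = x * y * \<bar>y - x + 1\<bar> / ((N + y) * (N - x))"
      using x y N Nx by (simp add: e_def abs_mult)
    also have "\<dots> \<le> (N / 2) * s / (N * (N / 2))"
      using x y N Nx xy by (intro frac_le mult_mono) (auto simp: s_def)
    also have "\<dots> = s / N" using N by simp
    also have "\<dots> \<le> s / (s\<^sup>2 / 2)" using Ns N s by (intro divide_left_mono) auto
    also have "\<dots> = 2 / s" by (simp add: power2_eq_square)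
    finally show ?thesis .
  qed
  have cube: "x * (u ^ 3 / 3) + y * (v ^ 3 / 3) \<le> 3 / s"
  proof -
    have "u \<le> x / N" unfolding u_def using x y N by (intro divide_left_mono) auto
    then have "x * (u ^ 3 / 3) \<le> x * ((x / N) ^ 3 / 3)"
      using uv x by (intro mult_left_mono divide_right_mono power_mono) auto
    moreover have "v \<le> y / (N / 2)" unfolding v_def using x y N Nx by (intro divide_left_mono) auto
    then have "y * (v ^ 3 / 3) \<le> y * ((y / (N / 2)) ^ 3 / 3)"
      using uv y by (intro mult_left_mono divide_right_mono power_mono) auto
    moreover have "x * ((x / N) ^ 3 / 3) \<le> 1 / (3 * N)"
    proof -
      have "x ^ 2 * x ^ 2 \<le> N * N" by (intro mult_mono) (auto simp: N_def)
      then show ?thesis using N by (simp add: field_simps power_divide eval_nat_numeral)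
    qed
    moreover have "y * ((y / (N / 2)) ^ 3 / 3) \<le> 8 / (3 * N)"
    proof -
      have "y ^ 2 * y ^ 2 \<le> N * N" by (intro mult_mono) (auto simp: N_def)
      then show ?thesis using N by (simp add: field_simps power_divide eval_nat_numeral)
    qed
    moreover have "1 / (3 * N) + 8 / (3 * N) = 3 / N" using N by (simp add: divide_simps)
    ultimately have "x * (u ^ 3 / 3) + y * (v ^ 3 / 3) \<le> 3 / N" by linarith
    also have "\<dots> \<le> 3 / s"
    proof -
      have "2 * s \<le> s * s" using s by (intro mult_right_mono) auto
      then have "s \<le> N" using Ns by (simp add: power2_eq_square)
      then show ?thesis using s by (intro divide_left_mono) auto
    qed
    finally show ?thesis .
  qed
  have "x * arctan u + y * arctan v \<le> x * u + y * v"
    using uv x y by (intro add_mono mult_left_mono arctan_le_self) auto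
  then have hi: "x * arctan u + y * arctan v - 1 \<le> 5 / s"
    using e_eq e s by (smt (verit) divide_right_mono)
  have "x * (u - u ^ 3 / 3) + y * (v - v ^ 3 / 3) \<le> x * arctan u + y * arctan v"
    using uv x y by (intro add_mono mult_left_mono arctan_ge_cubic) auto
  then have "x * arctan u + y * arctan v - 1 \<ge> e - (x * (u ^ 3 / 3) + y * (v ^ 3 / 3))"
    using e_eq by (simp add: algebra_simps)
  moreover have "2 / s + 3 / s = 5 / s" by (simp add: add_divide_distrib[symmetric])
  ultimately have lo: "x * arctan u + y * arctan v - 1 \<ge> - (5 / s)"
    using e cube by linarith
  have "\<bar>urn_gen urn_angle a b + 1\<bar> \<le> 5 / s"
    unfolding gen using hi lo by linarith
  then show ?thesis by (simp add: s_def x_def y_def)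
qed

section \<open>Supersolutions that absorb the error of the angle\<close>

definition urn_ratio :: "nat \<Rightarrow> nat \<Rightarrow> real" where
  "urn_ratio a b = real a / real (a + b)"

lemma urn_ratio_up:
  assumes "b \<ge> 1"
  shows "urn_ratio a (Suc b) - urn_ratio a b = - (real a / (real (a + b) * (real (a + b) + 1)))"
  using assms by (simp add: urn_ratio_def divide_simps) (simp add: algebra_simps)

lemma urn_ratio_left:
  assumes "a \<ge> 1" "b \<ge> 1"
  shows "urn_ratio (a - 1) b - urn_ratio a b = - (real b / (real (a + b) * (real (a + b) - 1)))"
proof -
  obtain c where "a = Suc c" using assms by (cases a) auto
  then show ?thesis
    using assms by (simp add: urn_ratio_def divide_simps) (simp add: algebra_simps)
qed

text \<open>Both kinds of jump lower the ratio, on the whole at rate about (x^2 + y^2)/s^2. The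
  constant 1/4 comes from x^2 + y^2 >= s^2/2 and s + 1 <= 2 s.\<close>

lemma urn_gen_ratio:
  assumes a: "a \<ge> 1" and b: "b \<ge> 1"
  shows "urn_gen urn_ratio a b \<le> - (1 / 4)"
proof -
  define x y s where "x = real a" and "y = real b" and "s = x + y"
  have x: "x \<ge> 1" and y: "y \<ge> 1" using assms by (auto simp: x_def y_def)
  have s: "s \<ge> 2" using x y by (simp add: s_def)
  have "urn_gen urn_ratio a b = - (x * x / (s * (s + 1)) + y * y / (s * (s - 1)))"
    unfolding urn_gen_def urn_ratio_up[OF b] urn_ratio_left[OF a b]
    by (simp add: x_def y_def s_def algebra_simps)
  moreover have "y * y / (s * (s - 1)) \<ge> y * y / (s * (s + 1))"
    using s by (intro divide_left_mono) auto
  moreover have "x * x / (s * (s + 1)) + y * y / (s * (s + 1)) \<ge> 1 / 4"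
  proof -
    have "0 \<le> (x - y)\<^sup>2" by simp
    then have "s * s \<le> 2 * (x * x + y * y)" by (simp add: s_def power2_eq_square algebra_simps)
    moreover have "s * 1 \<le> s * s" using s by (intro mult_left_mono) auto
    ultimately have "s * (s + 1) \<le> 4 * (x * x + y * y)" by (simp add: algebra_simps)
    then show ?thesis using s by (simp add: add_divide_distrib[symmetric] divide_simps)
  qed
  ultimately show ?thesis by linarith
qed

text \<open>
  The quadratic form \<open>a\<^sup>2 + b\<^sup>2 + a - b\<close> is harmonic for the urn; the shift by 1025 makes the estimate
  of \<open>urn_gen_radial\<close> hold near the origin as well.
\<close>
definition urn_quad :: "nat \<Rightarrow> nat \<Rightarrow> real" where
  "urn_quad a b = (real a)\<^sup>2 + (real b)\<^sup>2 + real a - real b + 1025"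

text \<open>A supersolution for a source of order 1/s^2. The plain reciprocal of the harmonic form
  has a generator of the wrong sign, but only of order s^-3. The factor 1 + ratio lies between 1 and
  2 and adds a negative term of order s^-2, which wins.\<close>

definition urn_radial :: "nat \<Rightarrow> nat \<Rightarrow> real" where
  "urn_radial a b = (1 + urn_ratio a b) / urn_quad a b"

lemma urn_quad_ge: "urn_quad a b \<ge> (real a)\<^sup>2 + 1000"
proof -
  have "0 \<le> (real b - 1)\<^sup>2 + real b" by simp
  then show ?thesis by (simp add: urn_quad_def power2_eq_square algebra_simps)
qed

lemma urn_quad_pos: "urn_quad a b > 0"
  using urn_quad_ge[of a b] by (smt (verit) zero_le_power2)

lemma urn_ratio_bounds: "0 \<le> urn_ratio a b" "urn_ratio a b \<le> 1"
  by (auto simp: urn_ratio_def divide_le_eq_1)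

lemma urn_gen_radial:
  assumes a: "a \<ge> 1" and b: "b \<ge> 1"
  shows "urn_gen urn_radial a b \<le> - (1 / (16 * urn_quad a b))"
proof -
  define x y N s Q g where "x = real a" and "y = real b" and "N = x\<^sup>2 + y\<^sup>2" and "s = x + y"
    and "Q = urn_quad a b" and "g = urn_ratio a b"
  have x: "x \<ge> 1" and y: "y \<ge> 1" using assms by (auto simp: x_def y_def)
  have s: "s \<ge> 2" using x y by (simp add: s_def)
  have "0 \<le> (x - y)\<^sup>2" by simp
  then have Ns: "N \<ge> s\<^sup>2 / 2" and xy: "x * y \<le> s\<^sup>2 / 4"
    by (auto simp: N_def s_def power2_eq_square algebra_simps)
  have Q: "Q = N + x - y + 1025" by (simp add: Q_def urn_quad_def x_def y_def N_def)
  have Q_up: "urn_quad a (Suc b) = Q + 2 * y"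
    by (simp add: Q_def urn_quad_def y_def power2_eq_square algebra_simps)
  have Q_left: "urn_quad (a - 1) b = Q - 2 * x"
    using a by (cases a) (auto simp: Q_def urn_quad_def x_def power2_eq_square algebra_simps)
  have "0 \<le> (y - 2)\<^sup>2 + x\<^sup>2 + y" using y by simp
  then have Q2b: "Q \<ge> 2 * y" using x by (simp add: Q N_def power2_eq_square algebra_simps)
  have Qm: "Q - 2 * x > 0" using urn_quad_pos[of "a - 1" b] unfolding Q_left .
  have Qp: "Q > 0" using Qm x by simp
  have g: "0 \<le> g" "g \<le> 1" using urn_ratio_bounds by (auto simp: g_def)
  define du dl where "du = urn_ratio a b - urn_ratio a (Suc b)" and "dl = urn_ratio a b - urn_ratio (a - 1) b"
  have "urn_ratio a (Suc b) - urn_ratio a b \<le> 0" unfolding urn_ratio_up[OF b] by simp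
  then have du: "du \<ge> 0" by (simp add: du_def)
  have "urn_ratio (a - 1) b - urn_ratio a b \<le> 0" unfolding urn_ratio_left[OF a b] using a by simp
  then have dl: "dl \<ge> 0" by (simp add: dl_def)
  have rat: "x * du + y * dl \<ge> 1 / 4"
    using urn_gen_ratio[OF a b] by (simp add: urn_gen_def du_def dl_def x_def y_def algebra_simps)
  have "urn_gen urn_radial a b
      = x * ((1 + g - du) / (Q + 2 * y) - (1 + g) / Q) + y * ((1 + g - dl) / (Q - 2 * x) - (1 + g) / Q)"
    unfolding urn_gen_def urn_radial_def Q_up Q_left
    by (simp add: x_def y_def g_def du_def dl_def Q_def[symmetric])
  also have "\<dots> = - (x * du / (Q + 2 * y) + y * dl / (Q - 2 * x))
      + (1 + g) * (x * (1 / (Q + 2 * y) - 1 / Q) + y * (1 / (Q - 2 * x) - 1 / Q))"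
    by (simp add: add_divide_distrib diff_divide_distrib algebra_simps)
  \<comment> \<open>The jumps of Q are 2 y at rate x and -2 x at rate y, so the first-order terms
    cancel and a second-order one remains.\<close>
  also have "x * (1 / (Q + 2 * y) - 1 / Q) + y * (1 / (Q - 2 * x) - 1 / Q)
      = 4 * x * y * s / ((Q - 2 * x) * (Q + 2 * y) * Q)"
    using Qm Qp y by (simp add: s_def divide_simps) (simp add: algebra_simps)
  finally have eq: "urn_gen urn_radial a b = - (x * du / (Q + 2 * y) + y * dl / (Q - 2 * x))
      + (1 + g) * (4 * x * y * s / ((Q - 2 * x) * (Q + 2 * y) * Q))" .
  have "x * du / (Q + 2 * y) \<ge> x * du / (2 * Q)"
    using x du Q2b Qp y by (intro divide_left_mono) auto
  moreover have "y * dl / (Q - 2 * x) \<ge> y * dl / (2 * Q)"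
    using x dl Qm Qp y by (intro divide_left_mono) auto
  moreover have "x * du / (2 * Q) + y * dl / (2 * Q) \<ge> (1 / 4) / (2 * Q)"
    unfolding add_divide_distrib[symmetric] using rat Qp by (intro divide_right_mono) auto
  ultimately have t1: "x * du / (Q + 2 * y) + y * dl / (Q - 2 * x) \<ge> 1 / (8 * Q)" by simp
  \<comment> \<open>With 1 + g <= 2, the factor 128 bounds the positive term by 8/128 = 1/16 of 1/Q,
    half of the gain 1/(8 Q) in \<open>t1\<close>.\<close>
  have main: "128 * (x * y * s) \<le> (Q - 2 * x) * (Q + 2 * y)"
  proof -
    have "128 * (x * y * s) \<le> 128 * (s\<^sup>2 / 4 * s)"
      using xy s by (intro mult_left_mono mult_right_mono) auto
    also have "\<dots> = 32 * s ^ 3" by (simp add: power2_eq_square eval_nat_numeral)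
    also have "\<dots> \<le> (s\<^sup>2 / 2 + 1025)\<^sup>2 - s\<^sup>2"
    proof -
      \<comment> \<open>This is the difference of the two sides: 1025 = 32^2 + 1 makes the terms in
        s^4, s^3 and s^2 a perfect square.\<close>
      have "0 \<le> s\<^sup>2 * (s / 2 - 32)\<^sup>2 + 1025\<^sup>2" by simp
      then show ?thesis by (simp add: power2_eq_square eval_nat_numeral algebra_simps)
    qed
    also have "\<dots> \<le> (N + 1025)\<^sup>2 - s\<^sup>2"
      using Ns by (intro diff_right_mono power_mono) auto
    \<comment> \<open>The two factors are N + 1025 - s and N + 1025 + s.\<close>
    also have "\<dots> = (Q - 2 * x) * (Q + 2 * y)"
      by (simp add: Q s_def power2_eq_square algebra_simps)
    finally show ?thesis .
  qed
  have "(1 + g) * (4 * x * y * s / ((Q - 2 * x) * (Q + 2 * y) * Q))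
      \<le> 2 * (4 * x * y * s / ((Q - 2 * x) * (Q + 2 * y) * Q))"
    using g x y s Qm Qp by (intro mult_right_mono) auto
  also have "\<dots> \<le> 1 / (16 * Q)"
    using main Qm Qp y by (simp add: divide_simps)
  finally have "urn_gen urn_radial a b \<le> - (1 / (8 * Q)) + 1 / (16 * Q)"
    using eq t1 by linarith
  also have "\<dots> = - (1 / (16 * Q))" using Qp by (simp add: divide_simps)
  finally show ?thesis by (simp add: Q_def)
qed

lemma time_solution_near_angle:
  assumes F0: "\<And>b. F 0 b = 0"
    and F: "\<And>a b. a \<ge> 1 \<Longrightarrow> urn_gen F a b = -1"
    and F_bdd: "\<And>a. \<exists>C. \<forall>b\<ge>1. \<bar>F a b\<bar> \<le> C"
    and n: "n \<ge> 1"
  shows "\<bar>F n 1 - urn_angle n 1\<bar> \<le> 100000 / real n"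
proof -
  define l where "l = 1 / real n"
  have l: "l > 0" using n by (simp add: l_def)
  \<comment> \<open>The factors 4 and 16 normalise the two generator bounds to -1 and -1/Q. The
    constant 1027 = 1 + 1 + 1025 comes from Q <= s^2 + s + 1025 <= 1027 s^2, and 5/2 turns a bound
    on 2/s into one on the angle error 5/s.\<close>
  define R where "R = (\<lambda>a b. 5 / 2 * (l * (4 * urn_ratio a b) + 1027 / l * (16 * urn_radial a b)))"
  have R_gen: "urn_gen R a b \<le> - (5 / real (a + b))" if a: "a \<ge> 1" and b: "b \<ge> 1" for a b
  proof -
    define Q s where "Q = urn_quad a b" and "s = real (a + b)"
    have Q: "Q > 0" using urn_quad_pos by (simp add: Q_def)
    have s: "s \<ge> 1" using a by (simp add: s_def)
    have "Q \<le> 1027 * s\<^sup>2"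
    proof -
      have "Q \<le> s\<^sup>2 + s + 1025" by (simp add: Q_def urn_quad_def s_def power2_eq_square algebra_simps)
      moreover have "s * 1 \<le> s * s" "1 * 1 \<le> s * s" using s by (intro mult_mono; simp)+
      ultimately show ?thesis by (simp add: power2_eq_square)
    qed
    then have "1 / s\<^sup>2 \<le> 1027 / Q" using Q s by (simp add: divide_simps)
    then have "1 / l * (1 / s\<^sup>2) \<le> 1 / l * (1027 / Q)" using l by (intro mult_left_mono) auto
    moreover have "2 / s \<le> l + 1 / l * (1 / s\<^sup>2)"
    proof -
      have "0 \<le> (l * s - 1)\<^sup>2 / (l * s\<^sup>2)" using l by simp
      also have "\<dots> = l + 1 / l * (1 / s\<^sup>2) - 2 / s"
        using l s by (simp add: divide_simps power2_eq_square) (simp add: algebra_simps)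
      finally show ?thesis by simp
    qed
    ultimately have key: "2 / s \<le> l + 1027 / l * (1 / Q)" by simp
    have "urn_gen R a b = 5 / 2 * (l * (4 * urn_gen urn_ratio a b) + 1027 / l * (16 * urn_gen urn_radial a b))"
      by (simp add: urn_gen_def R_def algebra_simps)
    also have "\<dots> \<le> 5 / 2 * (l * (4 * - (1 / 4)) + 1027 / l * (16 * - (1 / (16 * Q))))"
      using l urn_gen_ratio[OF a b] urn_gen_radial[OF a b]
      by (intro mult_left_mono add_mono) (auto simp: Q_def)
    also have "\<dots> = - (5 / 2 * (l + 1027 / l * (1 / Q)))" by (simp add: algebra_simps)
    also have "\<dots> \<le> - (5 / 2 * (2 / s))" using key by (intro le_imp_neg_le mult_left_mono) auto
    finally show ?thesis by (simp add: s_def)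
  qed
  have R0: "R a b \<ge> 0" for a b
    using l urn_ratio_bounds[of a b] urn_quad_pos[of a b] by (auto simp: R_def urn_radial_def)
  have ang: "0 \<le> urn_angle a b" "urn_angle a b \<le> pi / 2" for a b
    using arctan_ubound[of "real a / real b"] by (auto simp: urn_angle_def)
  have "(F n 1 - urn_angle n 1) - R n 1 \<le> 0"
  proof (rule urn_gen_max_principle[where D = "\<lambda>a b. F a b - urn_angle a b - R a b"])
    fix a b :: nat assume ab: "a \<ge> 1" "b \<ge> 1"
    show "0 \<le> urn_gen (\<lambda>a b. F a b - urn_angle a b - R a b) a b"
      unfolding urn_gen_diff using F[of a b] ab urn_gen_angle[OF ab] R_gen[OF ab] by linarith
  next
    fix a
    obtain C where "\<forall>b\<ge>1. \<bar>F a b\<bar> \<le> C" using F_bdd by blast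
    then have "\<forall>b\<ge>1. F a b - urn_angle a b - R a b \<le> C" using R0 ang by (smt (verit))
    then show "\<exists>C. \<forall>b\<ge>1. F a b - urn_angle a b - R a b \<le> C" by blast
  qed (use R0 in \<open>auto simp: F0 urn_angle_def\<close>)
  moreover have "(urn_angle n 1 - F n 1) - R n 1 \<le> 0"
  proof (rule urn_gen_max_principle[where D = "\<lambda>a b. urn_angle a b - F a b - R a b"])
    fix a b :: nat assume ab: "a \<ge> 1" "b \<ge> 1"
    show "0 \<le> urn_gen (\<lambda>a b. urn_angle a b - F a b - R a b) a b"
      unfolding urn_gen_diff using F[of a b] ab urn_gen_angle[OF ab] R_gen[OF ab] by linarith
  next
    fix a
    obtain C where "\<forall>b\<ge>1. \<bar>F a b\<bar> \<le> C" using F_bdd by blast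
    then have "\<forall>b\<ge>1. urn_angle a b - F a b - R a b \<le> pi / 2 + C" using R0 ang by (smt (verit))
    then show "\<exists>C. \<forall>b\<ge>1. urn_angle a b - F a b - R a b \<le> C" by blast
  qed (use R0 in \<open>auto simp: F0 urn_angle_def\<close>)
  \<comment> \<open>The weight 1/l = n cancels one power of n in the radial term; 5/2 (4 + 1027 *
    32) = 82170 is rounded up.\<close>
  moreover have "R n 1 \<le> 100000 / real n"
  proof -
    have "urn_quad n 1 \<ge> (real n)\<^sup>2" using urn_quad_ge[of n 1] by simp
    then have "urn_radial n 1 \<le> 2 / (real n)\<^sup>2"
      unfolding urn_radial_def using n urn_ratio_bounds[of n 1] by (intro frac_le) auto
    then have "R n 1 \<le> 5 / 2 * (l * (4 * 1) + 1027 / l * (16 * (2 / (real n)\<^sup>2)))"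
      unfolding R_def using l urn_ratio_bounds[of n 1] by (intro mult_left_mono add_mono) auto
    also have "\<dots> \<le> 100000 / real n" using n by (simp add: l_def power2_eq_square divide_simps)
    finally show ?thesis .
  qed
  ultimately show ?thesis by linarith
qed

text \<open>The factor m turns an O(1/m) error into a bounded one: 100000 from the comparison with
  the angle, 1 from the jump out of row 0, and 1 from the gap arctan (1/m) between pi/2 and
  \<open>urn_angle m 1\<close>. The linear term n pi/4 of the sum of m pi/2 accounts for the last
  unit in 100003.\<close>

lemma sum_time_solution_asymptotics:
  assumes F0: "\<And>b. F 0 b = 0"
    and F: "\<And>a b. a \<ge> 1 \<Longrightarrow> urn_gen F a b = -1"
    and F_bdd: "\<And>a. \<exists>C. \<forall>b\<ge>1. \<bar>F a b\<bar> \<le> C"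
  shows "\<bar>(\<Sum>m=1..n. real m * F m 0) - pi * (real n)\<^sup>2 / 4\<bar> \<le> 100003 * real n"
proof -
  have summand: "\<bar>real m * F m 0 - real m * (pi / 2)\<bar> \<le> 100002" if m: "m \<ge> 1" for m
  proof -
    have "real m * F m 0 = 1 + real m * F m 1"
      using F[OF m, of 0] by (simp add: urn_gen_def algebra_simps)
    moreover have "urn_angle m 1 = pi / 2 - arctan (1 / real m)"
      using arctan_inverse[of "real m"] m by (simp add: urn_angle_def sgn_if inverse_eq_divide)
    then have "real m * (pi / 2) = real m * urn_angle m 1 + real m * arctan (1 / real m)"
      by (simp add: distrib_left[symmetric])
    ultimately have "real m * F m 0 - real m * (pi / 2)
        = 1 + real m * (F m 1 - urn_angle m 1) - real m * arctan (1 / real m)"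
      by (simp add: algebra_simps)
    moreover have "\<bar>real m * (F m 1 - urn_angle m 1)\<bar> \<le> 100000"
      using mult_left_mono[OF time_solution_near_angle[OF F0 F F_bdd m], of "real m"] m
      by (simp add: abs_mult)
    moreover have "0 \<le> real m * arctan (1 / real m)" by simp
    moreover have "real m * arctan (1 / real m) \<le> 1"
      using mult_left_mono[OF arctan_le_self[of "1 / real m"], of "real m"] m by simp
    ultimately show ?thesis by linarith
  qed
  have gauss: "(\<Sum>m=1..n. real m * (pi / 2)) = pi * (real n)\<^sup>2 / 4 + real n * pi / 4"
    by (induction n) (auto simp: power2_eq_square field_simps)
  have "\<bar>(\<Sum>m=1..n. real m * F m 0) - (\<Sum>m=1..n. real m * (pi / 2))\<bar>
      \<le> (\<Sum>m=1..n. \<bar>real m * F m 0 - real m * (pi / 2)\<bar>)"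
    by (simp add: sum_subtractf[symmetric] sum_abs)
  also have "\<dots> \<le> (\<Sum>m=1..n. 100002)" using summand by (intro sum_mono) auto
  also have "\<dots> = 100002 * real n" by simp
  finally have "\<bar>(\<Sum>m=1..n. real m * F m 0) - (pi * (real n)\<^sup>2 / 4 + real n * pi / 4)\<bar> \<le> 100002 * real n"
    unfolding gauss .
  moreover have "real n * pi / 4 \<le> real n" using pi_less_4 mult_left_mono[of pi 4 "real n"] by simp
  moreover have "0 \<le> real n * pi / 4" by simp
  ultimately show ?thesis by linarith
qed

section \<open>Iterates of the one-step equation\<close>

text \<open>Expected reward collected in at most \<open>K\<close> jumps before reaching \<open>a = 0\<close>.\<close>
primrec urn_value :: "(nat \<Rightarrow> nat \<Rightarrow> real) \<Rightarrow> nat \<Rightarrow> nat \<Rightarrow> nat \<Rightarrow> real" where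
  "urn_value r 0 a b = 0"
| "urn_value r (Suc K) a b = (if a = 0 then 0 else r a b
     + real a / real (a + b) * urn_value r K a (Suc b)
     + real b / real (a + b) * urn_value r K (a - 1) b)"

definition urn_limit :: "(nat \<Rightarrow> nat \<Rightarrow> real) \<Rightarrow> nat \<Rightarrow> nat \<Rightarrow> real" where
  "urn_limit r a b = lim (\<lambda>K. urn_value r K a b)"

text \<open>The growth bound covers the three rewards per jump used later: 1, which counts jumps,
  the mean holding time 1/(a + b), and the mean area a^2/(a + b).\<close>

context
  fixes r :: "nat \<Rightarrow> nat \<Rightarrow> real"
  assumes r: "\<And>a b. 0 \<le> r a b" and r_le: "\<And>a b. r a b \<le> real (max 1 a)"
begin

lemma urn_value_nonneg: "0 \<le> urn_value r K a b"
  by (induction K arbitrary: a b) (auto simp: r)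

lemma urn_value_mono: "urn_value r K a b \<le> urn_value r (Suc K) a b"
proof (induction K arbitrary: a b)
  case 0
  then show ?case by (simp add: r)
next
  case (Suc K)
  show ?case
    unfolding urn_value.simps(2)[of r "Suc K" a b] urn_value.simps(2)[of r K a b]
    using Suc by (auto intro!: add_mono mult_left_mono divide_right_mono simp del: urn_value.simps)
qed

text \<open>\<open>S\<close> dominates the expected number of jumps. For b >= 1 each jump leaves
  column m with probability at least 1/(m + 1), so column m costs at most m + 1 jumps on average,
  and these add up to a (a + 3)/2. The extra 1 pays for the forced upward jump from row 0. Since a
  never increases, every reward is at most n.\<close>

lemma urn_value_le:
  assumes "a \<le> n" "n \<ge> 1"
  shows "urn_value r K a b \<le> real n * (real a * (real a + 3) / 2 + 1)"
proof -
  define S where "S = (\<lambda>(a::nat) (b::nat). real a * (real a + 3) / 2 + (if b = 0 then 1 else 0 :: real))"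
  have S: "1 + real a / real (a + b) * S a (Suc b) + real b / real (a + b) * S (a - 1) b \<le> S a b"
    if "a \<ge> 1" for a b :: nat
  proof (cases "b = 0")
    case True
    then show ?thesis using that by (simp add: S_def)
  next
    case False
    obtain c where c: "a = Suc c" using \<open>a \<ge> 1\<close> by (cases a) auto
    have "S a b - (1 + real a / real (a + b) * S a (Suc b) + real b / real (a + b) * S (a - 1) b)
      = (real b * (real a + 1)  - real (a + b)) / real (a + b)"
      using False unfolding c S_def by (simp add: divide_simps) (simp add: algebra_simps)
    moreover have "real a * 1 \<le> real a * real b" using False by (intro mult_left_mono) auto
    then have "0 \<le> (real b * (real a + 1)  - real (a + b)) / real (a + b)"
      by (auto simp: algebra_simps)
    ultimately show ?thesis by linarith
  qed
  have "urn_value r K a b \<le> real n * S a b" using assms(1)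
  proof (induction K arbitrary: a b)
    case 0
    then show ?case by (simp add: S_def)
  next
    case (Suc K)
    show ?case
    proof (cases "a = 0")
      case True
      then show ?thesis by (simp add: S_def)
    next
      case False
      have "r a b \<le> real n" using r_le[of a b] Suc.prems assms(2) False by (simp add: max_def split: if_splits)
      moreover have "real a / real (a + b) * urn_value r K a (Suc b) \<le> real a / real (a + b) * (real n * S a (Suc b))"
        "real b / real (a + b) * urn_value r K (a - 1) b \<le> real b / real (a + b) * (real n * S (a - 1) b)"
        using Suc by (intro mult_left_mono; simp)+
      ultimately have "urn_value r (Suc K) a b \<le>
          real n * (1 + real a / real (a + b) * S a (Suc b) + real b / real (a + b) * S (a - 1) b)"
        using False by (simp add: algebra_simps)
      also have "\<dots> \<le> real n * S a b" using S[of a b] False by (intro mult_left_mono) auto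
      finally show ?thesis .
    qed
  qed
  also have "\<dots> \<le> real n * (real a * (real a + 3) / 2 + 1)"
    by (intro mult_left_mono) (auto simp: S_def)
  finally show ?thesis .
qed

lemma urn_value_tendsto: "(\<lambda>K. urn_value r K a b) \<longlonglongrightarrow> urn_limit r a b"
proof -
  have "convergent (\<lambda>K. urn_value r K a b)"
  proof (rule Bseq_monoseq_convergent)
    show "Bseq (\<lambda>K. urn_value r K a b)"
      using urn_value_le[of a "max 1 a"] urn_value_nonneg
      by (intro BseqI'[where K = "real (max 1 a) * (real a * (real a + 3) / 2 + 1)"]) auto
    show "monoseq (\<lambda>K. urn_value r K a b)"
      using urn_value_mono by (intro mono_SucI1) auto
  qed
  then show ?thesis by (simp add: urn_limit_def convergent_LIMSEQ_iff)
qed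

lemma urn_limit_0: "urn_limit r 0 b = 0"
proof -
  have "urn_value r K 0 b = 0" for K by (cases K) auto
  then show ?thesis by (simp add: urn_limit_def)
qed

text \<open>The recursion describes the jump chain and the generator continuous time; the total rate
  a + b converts one into the other.\<close>

lemma urn_gen_limit:
  assumes "a \<ge> 1"
  shows "urn_gen (urn_limit r) a b = - (real (a + b) * r a b)"
proof -
  have "(\<lambda>K. urn_value r (Suc K) a b) \<longlonglongrightarrow> r a b
      + real a / real (a + b) * urn_limit r a (Suc b) + real b / real (a + b) * urn_limit r (a - 1) b"
    using assms by (auto intro!: tendsto_intros urn_value_tendsto)
  moreover have "(\<lambda>K. urn_value r (Suc K) a b) \<longlonglongrightarrow> urn_limit r a b"
    using urn_value_tendsto LIMSEQ_Suc by blast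
  ultimately have "urn_limit r a b = r a b
      + real a / real (a + b) * urn_limit r a (Suc b) + real b / real (a + b) * urn_limit r (a - 1) b"
    using LIMSEQ_unique by blast
  then have "real (a + b) * urn_limit r a b = real (a + b) * (r a b
      + real a / real (a + b) * urn_limit r a (Suc b) + real b / real (a + b) * urn_limit r (a - 1) b)"
    by simp
  also have "\<dots> = real (a + b) * r a b + real a * urn_limit r a (Suc b) + real b * urn_limit r (a - 1) b"
    unfolding distrib_left using assms by simp
  finally have "real (a + b) * urn_limit r a b
      = real (a + b) * r a b + real a * urn_limit r a (Suc b) + real b * urn_limit r (a - 1) b" .
  then show ?thesis by (simp add: urn_gen_def algebra_simps)
qed

lemma urn_limit_bounded: "\<exists>C. \<forall>b\<ge>1. \<bar>urn_limit r a b\<bar> \<le> C"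
proof -
  let ?C = "real (max 1 a) * (real a * (real a + 3) / 2 + 1)"
  have "\<bar>urn_limit r a b\<bar> \<le> ?C" for b
  proof -
    have "0 \<le> urn_limit r a b"
      by (rule LIMSEQ_le_const[OF urn_value_tendsto]) (use urn_value_nonneg in auto)
    moreover have "urn_limit r a b \<le> ?C"
      by (rule LIMSEQ_le_const2[OF urn_value_tendsto]) (use urn_value_le[of a "max 1 a"] in auto)
    ultimately show ?thesis by simp
  qed
  then show ?thesis by blast
qed

end

section \<open>The area under a staircase\<close>

lemma closed_segment_Pair_fst: "closed_segment (x, y) (x, y') = {x} \<times> closed_segment y y'"
  for x :: "'a::real_vector" and y y' :: "'b::real_vector"
  by (auto simp: closed_segment_def scaleR_left_distrib[symmetric])

lemma closed_segment_Pair_snd: "closed_segment (x, y) (x', y) = closed_segment x x' \<times> {y}"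
  for x x' :: "'a::real_vector" and y :: "'b::real_vector"
  by (auto simp: closed_segment_def scaleR_left_distrib[symmetric])

lemma emeasure_lborel_rectangle:
  fixes a b c d :: real
  assumes "a \<le> b" "c \<le> d"
  shows "emeasure lborel ({a..b} \<times> {c..d}) = ennreal ((b - a) * (d - c))"
    and "emeasure lborel ({a<..<b} \<times> {c<..<d}) = ennreal ((b - a) * (d - c))"
proof -
  have "{a..b} \<times> {c..d} = cbox (a, c) (b, d)" "{a<..<b} \<times> {c<..<d} = box (a, c) (b, d)"
    by (auto simp: box_def Basis_prod_def)
  then show "emeasure lborel ({a..b} \<times> {c..d}) = ennreal ((b - a) * (d - c))"
    "emeasure lborel ({a<..<b} \<times> {c<..<d}) = ennreal ((b - a) * (d - c))"
    using assms by (auto simp: emeasure_lborel_cbox_eq emeasure_lborel_box_eq Basis_prod_def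
        prod.union_disjoint prod.reindex inj_on_def)
qed

locale staircase =
  fixes a b :: "nat \<Rightarrow> nat" and H :: nat
  assumes b_0: "b 0 = 0" and a_H: "a H = 0"
    and moves: "\<And>k. k < H \<Longrightarrow> a (Suc k) = a k \<and> b (Suc k) = Suc (b k) \<or> a k = Suc (a (Suc k)) \<and> b (Suc k) = b k"
begin

definition stairs :: "(real \<times> real) set" where
  "stairs = (\<Union>k<H. closed_segment (real (a k), real (b k)) (real (a (Suc k)), real (b (Suc k))))"

text \<open>Boxes anchored at the origin make the polygon a down-set, so a diagonal ray leaving it never returns.\<close>
definition polygon :: "(real \<times> real) set" where
  "polygon = (\<Union>k<H. {0..real (a k)} \<times> {0..real (b (Suc k))})"

text \<open>Open strips avoid the path and each other. A left move contributes an empty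
  strip.\<close>

definition cells :: "(real \<times> real) set" where
  "cells = (\<Union>k<H. {0<..<real (a k)} \<times> {real (b k)<..<real (b (Suc k))})"

definition axes :: "(real \<times> real) set" where
  "axes = {p. fst p = 0 \<or> snd p = 0}"

definition region :: "(real \<times> real) set" where
  "region = {p. 0 < fst p \<and> 0 < snd p} \<inter> inside (axes \<union> stairs)"

lemma a_antimono: "j \<le> k \<Longrightarrow> k \<le> H \<Longrightarrow> a k \<le> a j"
proof (induction k rule: dec_induct)
  case (step m)
  then show ?case using moves[of m] by auto
qed simp

lemma b_mono: "j \<le> k \<Longrightarrow> k \<le> H \<Longrightarrow> b j \<le> b k"
proof (induction k rule: dec_induct)
  case (step m)
  then show ?case using moves[of m] by auto
qed simp

lemma segment_up:
  assumes "k < H" "b (Suc k) \<noteq> b k"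
  shows "closed_segment (real (a k), real (b k)) (real (a (Suc k)), real (b (Suc k)))
    = {real (a k)} \<times> {real (b k)..real (b (Suc k))}"
  using moves[OF assms(1)] assms(2)
  by (auto simp: closed_segment_Pair_fst closed_segment_eq_real_ivl)

lemma segment_left:
  assumes "k < H" "b (Suc k) = b k"
  shows "closed_segment (real (a k), real (b k)) (real (a (Suc k)), real (b (Suc k)))
    = {real (a (Suc k))..real (a k)} \<times> {real (b k)}"
  using moves[OF assms(1)] assms(2)
  by (auto simp: closed_segment_Pair_snd closed_segment_eq_real_ivl)

lemma stairs_subset_polygon: "stairs \<subseteq> polygon"
proof
  fix p assume "p \<in> stairs"
  then obtain k where k: "k < H"
    "p \<in> closed_segment (real (a k), real (b k)) (real (a (Suc k)), real (b (Suc k)))"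
    by (auto simp: stairs_def)
  then have "p \<in> {0..real (a k)} \<times> {0..real (b (Suc k))}"
    using segment_up[OF k(1)] segment_left[OF k(1)]
    by (cases "b (Suc k) = b k") fastforce+
  then show "p \<in> polygon" using k(1) by (auto simp: polygon_def)
qed

text \<open>A point of a cell has a height strictly between consecutive integers, which no
  horizontal edge has. The only vertical edge at that height is the right side of the same
  cell.\<close>

lemma cells_disjoint_stairs: "cells \<inter> stairs = {}"
proof -
  have False if pc: "p \<in> cells" and pp: "p \<in> stairs" for p
  proof -
    obtain x y where p: "p = (x, y)" by (cases p)
    obtain k where k: "k < H" "x < real (a k)" "real (b k) < y" "y < real (b (Suc k))"
      using pc by (auto simp: cells_def p)
    obtain i where i: "i < H"
      "p \<in> closed_segment (real (a i), real (b i)) (real (a (Suc i)), real (b (Suc i)))"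
      using pp by (auto simp: stairs_def)
    have bk: "b (Suc k) = Suc (b k)" "a (Suc k) = a k" using moves[OF k(1)] k(3,4) by auto
    show False
    proof (cases "b (Suc i) = b i")
      case True
      then have "y = real (b i)" using i segment_left[OF i(1)] by (auto simp: p)
      then show False using k bk by simp
    next
      case False
      then have xy: "x = real (a i)" "real (b i) \<le> y" "y \<le> real (b (Suc i))"
        using i segment_up[OF i(1)] by (auto simp: p)
      have bi: "b (Suc i) = Suc (b i)" "a (Suc i) = a i" using moves[OF i(1)] False by auto
      have "\<not> i < k" using b_mono[of "Suc i" k] k xy by auto
      moreover have "\<not> k < i" using b_mono[of "Suc k" i] i k xy by auto
      ultimately have "i = k" by simp
      then show False using xy k by simp
    qed
  qed
  then show ?thesis by blast
qed

lemma cells_subset_polygon: "cells \<subseteq> polygon"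
proof -
  have "{real (b k)<..<real (b (Suc k))} \<subseteq> {0..real (b (Suc k))}" for k
    using of_nat_0_le_iff[of "b k", where 'a = real] by (auto simp del: of_nat_0_le_iff)
  then show ?thesis
    unfolding cells_def polygon_def by (intro UN_mono order_refl Sigma_mono) auto
qed

text \<open>Let k be the last index with x <= a k: move k goes left across x, so y <= b k, and
  equality would put the point on that edge. Let j be the last index with b j <= y: move j goes up
  past y, so x <= a j, and again equality would put the point on the edge. Thus both inequalities
  are strict for the box of j.\<close>

lemma interior_point:
  assumes xy: "(x, y) \<in> polygon" "0 < x" "0 < y" "(x, y) \<notin> stairs"
  obtains k where "k < H" "x < real (a k)" "y < real (b (Suc k))"
proof -
  obtain k0 where k0: "k0 < H" "x \<le> real (a k0)" "y \<le> real (b (Suc k0))"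
    using xy(1) by (auto simp: polygon_def)
  define k where "k = Greatest (\<lambda>k. k \<le> H \<and> x \<le> real (a k))"
  have kk: "k \<le> H \<and> x \<le> real (a k)"
    unfolding k_def by (rule GreatestI_nat[where b = H and k = k0]) (use k0 in auto)
  have k_max: "k' \<le> k" if "k' \<le> H" "x \<le> real (a k')" for k'
    unfolding k_def by (rule Greatest_le_nat[where b = H]) (use that in auto)
  have kH: "k < H" using kk a_H xy(2) by (metis le_neq_implies_less not_le of_nat_0)
  have "\<not> x \<le> real (a (Suc k))" using k_max[of "Suc k"] kH by auto
  then have sk: "a k = Suc (a (Suc k))" "b (Suc k) = b k" using moves[OF kH] kk by auto
  have "y \<le> real (b k)" using b_mono[of "Suc k0" "Suc k"] k_max[of k0] k0 kH sk by auto
  moreover have "y \<noteq> real (b k)"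
  proof
    assume "y = real (b k)"
    then have "(x, y) \<in> closed_segment (real (a k), real (b k)) (real (a (Suc k)), real (b (Suc k)))"
      unfolding segment_left[OF kH sk(2)] using kk \<open>\<not> x \<le> real (a (Suc k))\<close> by simp
    then have "(x, y) \<in> stairs" using kH unfolding stairs_def by blast
    then show False using xy by simp
  qed
  ultimately have y: "y < real (b k)" by simp
  define j where "j = Greatest (\<lambda>j. j \<le> H \<and> real (b j) \<le> y)"
  have jj: "j \<le> H \<and> real (b j) \<le> y"
    unfolding j_def by (rule GreatestI_nat[where b = H and k = 0]) (use xy b_0 in auto)
  have j_max: "j' \<le> j" if "j' \<le> H" "real (b j') \<le> y" for j'
    unfolding j_def by (rule Greatest_le_nat[where b = H]) (use that in auto)
  have jk: "j < k"
  proof (rule ccontr)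
    assume "\<not> j < k"
    then have "b k \<le> b j" using b_mono jj by auto
    then show False using jj y by auto
  qed
  have yj: "y < real (b (Suc j))" using j_max[of "Suc j"] jk kH by (auto simp: not_le[symmetric])
  have xj: "x \<le> real (a j)" using a_antimono[of j k] jk kH kk by auto
  have "x \<noteq> real (a j)"
  proof
    assume "x = real (a j)"
    moreover have "j < H" "b (Suc j) \<noteq> b j" using jk kH jj yj by auto
    ultimately have "(x, y) \<in> closed_segment (real (a j), real (b j)) (real (a (Suc j)), real (b (Suc j)))"
      using jj yj by (simp add: segment_up)
    then have "(x, y) \<in> stairs" using \<open>j < H\<close> unfolding stairs_def by blast
    then show False using xy by simp
  qed
  then show ?thesis using that[of j] jk kH xj yj by auto
qed

text \<open>A connected set that avoids the axes and the path therefore cannot leave the polygon.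
  The strict inequalities of \<open>interior_point\<close> give an open box around any point that
  would violate this.\<close>

lemma frontier_polygon_subset: "frontier polygon \<subseteq> axes \<union> stairs"
proof
  fix p assume p: "p \<in> frontier polygon"
  have "closed polygon" unfolding polygon_def by (intro closed_UN) (auto intro!: closed_Times)
  then have pP: "p \<in> polygon" "p \<notin> interior polygon" using p by (auto simp: frontier_def)
  obtain x y where xy: "p = (x, y)" by (cases p)
  show "p \<in> axes \<union> stairs"
  proof (rule ccontr)
    assume n: "p \<notin> axes \<union> stairs"
    then have pos: "0 < x" "0 < y" using pP(1) by (auto simp: xy polygon_def axes_def)
    obtain k where k: "k < H" "x < real (a k)" "y < real (b (Suc k))"
      using interior_point[of x y] pP(1) n pos by (auto simp: xy)
    let ?U = "{0<..<real (a k)} \<times> {0<..<real (b (Suc k))}"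
    have "?U \<subseteq> polygon" using k(1) by (auto simp: polygon_def intro!: bexI[of _ k])
    moreover have "open ?U" by (intro open_Times) auto
    ultimately have "?U \<subseteq> interior polygon" by (rule interior_maximal)
    moreover have "p \<in> ?U" using pos k by (simp add: xy)
    ultimately show False using pP(2) by blast
  qed
qed

lemma bounded_polygon: "bounded polygon"
  unfolding polygon_def by (intro bounded_UN) (auto intro!: bounded_Times)

lemma cells_subset_region: "cells \<subseteq> region"
proof
  fix p assume p: "p \<in> cells"
  have pos: "0 < fst p" "0 < snd p" using p by (auto simp: cells_def)
  have nS: "p \<notin> axes \<union> stairs" using p pos cells_disjoint_stairs by (auto simp: axes_def)
  let ?C = "connected_component_set (- (axes \<union> stairs)) p"
  have "?C \<subseteq> polygon"
  proof (rule ccontr)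
    assume "\<not> ?C \<subseteq> polygon"
    moreover have "p \<in> ?C" using nS by (simp add: connected_component_refl)
    ultimately have "?C \<inter> frontier polygon \<noteq> {}"
      using p cells_subset_polygon by (intro connected_Int_frontier connected_connected_component) blast+
    moreover have "?C \<subseteq> - (axes \<union> stairs)" by (rule connected_component_subset)
    ultimately show False using frontier_polygon_subset by blast
  qed
  then have "bounded ?C" using bounded_polygon bounded_subset by blast
  then show "p \<in> region" using nS pos by (auto simp: region_def inside_def)
qed

text \<open>The diagonal ray from a point outside the polygon misses axes and path, so the component
  of that point is unbounded.\<close>

lemma region_subset_polygon: "region \<subseteq> polygon"
proof
  fix p assume p: "p \<in> region"
  obtain x y where xy: "p = (x, y)" by (cases p)
  have pos: "0 < x" "0 < y" using p by (auto simp: region_def xy)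
  show "p \<in> polygon"
  proof (rule ccontr)
    assume n: "p \<notin> polygon"
    define R where "R = (\<lambda>t. (x + t, y + t)) ` {0::real..}"
    have "connected R" unfolding R_def
      by (intro connected_continuous_image continuous_intros) auto
    moreover have "R \<inter> polygon = {}"
    proof -
      have False if "t \<ge> 0" "(x + t, y + t) \<in> polygon" for t
      proof -
        have "(x, y) \<in> polygon" using that pos by (auto simp: polygon_def intro!: bexI)
        then show False using n xy by simp
      qed
      then show ?thesis by (auto simp: R_def)
    qed
    then have "R \<subseteq> - (axes \<union> stairs)" using stairs_subset_polygon pos by (auto simp: R_def axes_def)
    moreover have "p \<in> R" by (auto simp: R_def xy intro!: image_eqI[of _ _ 0])
    ultimately have "R \<subseteq> connected_component_set (- (axes \<union> stairs)) p"
      by (intro connected_component_maximal)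
    moreover have "bounded (connected_component_set (- (axes \<union> stairs)) p)"
      using p by (auto simp: region_def inside_def)
    ultimately have "bounded (fst ` R)" using bounded_subset bounded_fst by blast
    then obtain c where c: "\<And>z. z \<in> fst ` R \<Longrightarrow> \<bar>z\<bar> \<le> c" by (auto simp: bounded_iff)
    have "x + (\<bar>c\<bar> + 1) \<in> fst ` R" by (auto simp: R_def image_image)
    then show False using c[of "x + (\<bar>c\<bar> + 1)"] pos by auto
  qed
qed

lemma emeasure_polygon_le:
  "emeasure lborel polygon \<le> (\<Sum>k<H. ennreal (real (a k) * real (b (Suc k) - b k)))"
proof -
  have "polygon \<subseteq> (\<Union>k<H. {0..real (a k)} \<times> {real (b k)..real (b (Suc k))})"
  proof
    fix p assume "p \<in> polygon"
    then obtain x y k where p: "p = (x, y)" "k < H" "0 \<le> x" "x \<le> real (a k)" "0 \<le> y" "y \<le> real (b (Suc k))"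
      by (auto simp: polygon_def)
    \<comment> \<open>The boxes overlap, so the point is assigned to the first strip that reaches
      its height. Since a decreases along the path, x still fits.\<close>
    define j where "j = Least (\<lambda>j. y \<le> real (b (Suc j)))"
    have j: "y \<le> real (b (Suc j))" unfolding j_def by (rule LeastI[of _ k]) (use p in auto)
    have jk: "j \<le> k" unfolding j_def by (rule Least_le) (use p in auto)
    have "real (b j) \<le> y"
    proof (cases j)
      case 0
      then show ?thesis using b_0 p by simp
    next
      case (Suc i)
      then have "\<not> y \<le> real (b (Suc i))" using not_less_Least[of i "\<lambda>j. y \<le> real (b (Suc j))"] by (simp add: j_def)
      then show ?thesis using Suc by simp
    qed
    moreover have "x \<le> real (a j)" using a_antimono[OF jk] p by auto
    ultimately show "p \<in> (\<Union>k<H. {0..real (a k)} \<times> {real (b k)..real (b (Suc k))})"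
      using j jk p by (auto intro!: bexI[of _ j])
  qed
  then have "emeasure lborel polygon \<le> emeasure lborel (\<Union>k<H. {0..real (a k)} \<times> {real (b k)..real (b (Suc k))})"
    by (intro emeasure_mono) (auto intro!: sets.finite_UN borel_closed closed_Times)
  also have "\<dots> \<le> (\<Sum>k<H. emeasure lborel ({0..real (a k)} \<times> {real (b k)..real (b (Suc k))}))"
    by (intro emeasure_subadditive_finite) (auto intro!: borel_closed closed_Times)
  also have "\<dots> = (\<Sum>k<H. ennreal (real (a k) * real (b (Suc k) - b k)))"
    using b_mono by (intro sum.cong refl) (simp add: emeasure_lborel_rectangle of_nat_diff)
  finally show ?thesis .
qed

lemma emeasure_cells:
  "emeasure lborel cells = (\<Sum>k<H. ennreal (real (a k) * real (b (Suc k) - b k)))"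
proof -
  have disj: "disjoint_family_on (\<lambda>k. {0<..<real (a k)} \<times> {real (b k)<..<real (b (Suc k))}) {..<H}"
  proof -
    let ?c = "\<lambda>k. {0<..<real (a k)} \<times> {real (b k)<..<real (b (Suc k))}"
    have less: "?c i \<inter> ?c k = {}" if "i < k" "k < H" for i k
    proof -
      have "real (b (Suc i)) \<le> real (b k)" using b_mono[of "Suc i" k] that by simp
      then show ?thesis by auto
    qed
    show ?thesis
      unfolding disjoint_family_on_def
    proof (intro ballI impI)
      fix i k assume "i \<in> {..<H}" "k \<in> {..<H}" "i \<noteq> k"
      then show "?c i \<inter> ?c k = {}" using less[of i k] less[of k i] by (cases i k rule: linorder_cases) blast+
    qed
  qed
  have "emeasure lborel cells
      = (\<Sum>k<H. emeasure lborel ({0<..<real (a k)} \<times> {real (b k)<..<real (b (Suc k))}))"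
    unfolding cells_def
    by (rule sum_emeasure[symmetric]) (auto simp: disj intro!: borel_open open_Times)
  also have "\<dots> = (\<Sum>k<H. ennreal (real (a k) * real (b (Suc k) - b k)))"
    using b_mono by (intro sum.cong refl) (simp add: emeasure_lborel_rectangle of_nat_diff)
  finally show ?thesis .
qed

text \<open>The region is squeezed between \<open>cells\<close> and \<open>polygon\<close>, which
  have the same measure because they differ by edges only. No exact description of
  \<open>inside\<close> is required.\<close>

lemma emeasure_region:
  "emeasure lborel region = (\<Sum>k<H. ennreal (real (a k) * real (b (Suc k) - b k)))"
proof (rule antisym)
  have "closed axes"
    unfolding axes_def by (intro closed_Collect_disj closed_Collect_eq continuous_intros)
  moreover have "closed stairs" unfolding stairs_def by (intro closed_UN) auto
  ultimately have "open (inside (axes \<union> stairs))" by (intro open_inside) auto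
  moreover have "open {p::real \<times> real. 0 < fst p \<and> 0 < snd p}"
    by (intro open_Collect_conj open_Collect_less continuous_intros)
  ultimately have region: "region \<in> sets lborel" unfolding region_def by (auto intro!: borel_open)
  have polygon: "polygon \<in> sets lborel"
    unfolding polygon_def by (auto intro!: sets.finite_UN borel_closed closed_Times)
  show "emeasure lborel region \<le> (\<Sum>k<H. ennreal (real (a k) * real (b (Suc k) - b k)))"
    using emeasure_mono[OF region_subset_polygon polygon] emeasure_polygon_le by (rule order_trans)
  show "(\<Sum>k<H. ennreal (real (a k) * real (b (Suc k) - b k))) \<le> emeasure lborel region"
    using emeasure_mono[OF cells_subset_region region] by (simp add: emeasure_cells)
qed

end

section \<open>The jump chain of the urn\<close>

definition urn_up :: "int \<times> int \<Rightarrow> int \<times> int" where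
  "urn_up z = (fst z, snd z + sgn (fst z))"

definition urn_left :: "int \<times> int \<Rightarrow> int \<times> int" where
  "urn_left z = (fst z - sgn (snd z), snd z)"

abbreviation urn_states :: "(int \<times> int) set" where
  "urn_states \<equiv> - {(0, 0)}"

abbreviation urn_prob :: "int \<times> int \<Rightarrow> int \<times> int \<Rightarrow> real" where
  "urn_prob \<equiv> jump_prob urn_states urn_rate"

lemma urn_up_in_states: "z \<in> urn_states \<Longrightarrow> urn_up z \<in> urn_states"
  and urn_left_in_states: "z \<in> urn_states \<Longrightarrow> urn_left z \<in> urn_states"
  by (cases z; auto simp: urn_up_def urn_left_def)+

lemma urn_up_neq_left: "z \<in> urn_states \<Longrightarrow> urn_up z \<noteq> urn_left z"
  by (cases z) (auto simp: urn_up_def urn_left_def sgn_if split: if_splits)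

lemma urn_rate_alt:
  "urn_rate z w = (if w = urn_left z then real_of_int \<bar>snd z\<bar> else 0)
    + (if w = urn_up z then real_of_int \<bar>fst z\<bar> else 0)"
  by (cases z) (simp add: urn_rate_def urn_left_def urn_up_def)

lemma urn_rate_self: "urn_rate z z = 0"
  by (cases z) (auto simp: urn_rate_def sgn_0_0)

lemma exit_rate_urn:
  assumes z: "z \<in> urn_states"
  shows "exit_rate urn_states urn_rate z = real_of_int (\<bar>fst z\<bar> + \<bar>snd z\<bar>)"
proof -
  have "exit_rate urn_states urn_rate z = infsum (urn_rate z) ({urn_left z, urn_up z} - {z})"
    unfolding exit_rate_def
    by (rule infsum_cong_neutral)
      (use urn_up_in_states[OF z] urn_left_in_states[OF z] in \<open>auto simp: urn_rate_alt\<close>)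
  also have "\<dots> = sum (urn_rate z) ({urn_left z, urn_up z} - {z})" by simp
  also have "\<dots> = sum (urn_rate z) {urn_left z, urn_up z}"
    by (rule sum.mono_neutral_left) (auto simp: urn_rate_self)
  also have "\<dots> = real_of_int (\<bar>fst z\<bar> + \<bar>snd z\<bar>)"
    using urn_up_neq_left[OF z] by (simp add: urn_rate_alt eq_commute[of "urn_left z" "urn_up z"])
  finally show ?thesis .
qed

text \<open>On the vertical axis \<open>urn_up\<close> does not move, and both sides are 0; this
  keeps the formula uniform over all states.\<close>

lemma urn_prob_up:
  assumes z: "z \<in> urn_states"
  shows "urn_prob z (urn_up z) = real_of_int \<bar>fst z\<bar> / real_of_int (\<bar>fst z\<bar> + \<bar>snd z\<bar>)"
proof (cases "fst z = 0")
  case True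
  then have "urn_up z = z" by (simp add: urn_up_def prod_eq_iff)
  then show ?thesis using True by (simp add: jump_prob_def)
next
  case False
  then have "urn_up z \<noteq> z" by (auto simp: urn_up_def prod_eq_iff sgn_0_0)
  then show ?thesis
    using urn_up_neq_left[OF z] unfolding jump_prob_def exit_rate_urn[OF z] by (auto simp: urn_rate_alt)
qed

lemma urn_prob_left:
  assumes z: "z \<in> urn_states"
  shows "urn_prob z (urn_left z) = real_of_int \<bar>snd z\<bar> / real_of_int (\<bar>fst z\<bar> + \<bar>snd z\<bar>)"
proof (cases "snd z = 0")
  case True
  then have "urn_left z = z" by (simp add: urn_left_def prod_eq_iff)
  then show ?thesis using True by (simp add: jump_prob_def)
next
  case False
  then have "urn_left z \<noteq> z" by (auto simp: urn_left_def prod_eq_iff sgn_0_0)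
  then show ?thesis
    using urn_up_neq_left[OF z] unfolding jump_prob_def exit_rate_urn[OF z] by (auto simp: urn_rate_alt)
qed

lemma urn_prob_up_left_sum:
  assumes z: "z \<in> urn_states"
  shows "urn_prob z (urn_up z) + urn_prob z (urn_left z) = 1"
proof -
  have "real_of_int (\<bar>fst z\<bar> + \<bar>snd z\<bar>) \<noteq> 0" using z by (cases z) (auto simp: add_eq_0_iff_both_eq_0 add_nonneg_eq_0_iff simp flip: of_int_add)
  then show ?thesis
    unfolding urn_prob_up[OF z] urn_prob_left[OF z] by (simp add: add_divide_distrib[symmetric])
qed

section \<open>Traversal time and area of a single trajectory\<close>

definition urn_step :: "int \<times> int \<Rightarrow> int \<times> int \<Rightarrow> bool" where
  "urn_step z w \<longleftrightarrow> fst z \<noteq> 0 \<and> w = urn_up z \<or> snd z \<noteq> 0 \<and> w = urn_left z"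

text \<open>Collects the properties that almost every trajectory has; H is the index of the first
  state on the vertical axis.\<close>

locale urn_path =
  fixes x :: "real \<Rightarrow> int \<times> int" and n H :: nat
  assumes start: "jump_chain x 0 = (int n, 0)"
    and hold_pos: "\<And>k. 0 < holding_time x k"
    and steps: "\<And>k. urn_step (jump_chain x k) (jump_chain x (Suc k))"
    and hit: "fst (jump_chain x H) = 0" and before: "\<And>k. k < H \<Longrightarrow> fst (jump_chain x k) \<noteq> 0"
begin

lemma nonneg: "k \<le> H \<Longrightarrow> 0 \<le> fst (jump_chain x k) \<and> 0 \<le> snd (jump_chain x k)"
proof (induction k)
  case 0
  then show ?case by (simp add: start)
next
  case (Suc k)
  then show ?case using steps[of k] before[of k]
    by (auto simp: urn_step_def urn_up_def urn_left_def sgn_if)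
qed

lemma fst_pos: "k < H \<Longrightarrow> 0 < fst (jump_chain x k)"
  using nonneg[of k] before[of k] by simp

lemma jump_time_strict_mono: "strict_mono (jump_time x)"
  using hold_pos by (intro strict_monoI_Suc) (simp add: holding_time_def)

lemma jump_time_nonneg: "0 \<le> jump_time x k"
  using strict_mono_less_eq[OF jump_time_strict_mono, of 0 k] by simp

lemma constant_between_jumps:
  assumes "jump_time x k \<le> t" "t < jump_time x (Suc k)"
  shows "x t = jump_chain x k"
proof (rule ccontr)
  assume ne: "x t \<noteq> jump_chain x k"
  then have "jump_time x k < t" using assms(1) by (cases "t = jump_time x k") (auto simp: jump_chain_def)
  then have "jump_time x (Suc k) \<le> t"
    using ne by (auto simp: jump_chain_def intro!: cInf_lower bdd_belowI[of _ "jump_time x k"])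
  then show False using assms(2) by simp
qed

text \<open>The first H holding intervals cover all times before the H-th jump, and on each of them
  the path sits at a state off the vertical axis.\<close>

lemma traversal_time_eq_jump_time: "traversal_time x = ennreal (jump_time x H)"
proof (rule antisym)
  show "traversal_time x \<le> ennreal (jump_time x H)"
    unfolding traversal_time_def using jump_time_nonneg hit
    by (intro Inf_lower) (auto simp: jump_chain_def)
  show "ennreal (jump_time x H) \<le> traversal_time x"
    unfolding traversal_time_def
  proof (rule Inf_greatest)
    fix s assume "s \<in> ennreal ` {t. 0 \<le> t \<and> fst (x t) = 0}"
    then obtain t where t: "s = ennreal t" "0 \<le> t" "fst (x t) = 0" by auto
    have "\<not> t < jump_time x H"
    proof
      assume tH: "t < jump_time x H"
      define m where "m = Least (\<lambda>m. t < jump_time x m)"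
      have m: "t < jump_time x m" unfolding m_def using tH by (rule LeastI)
      have mH: "m \<le> H" unfolding m_def using tH by (rule Least_le)
      obtain k where k: "m = Suc k" using m t(2) by (cases m) auto
      have "jump_time x k \<le> t"
        using not_less_Least[of k "\<lambda>m. t < jump_time x m"] k by (simp add: m_def[symmetric])
      then have "x t = jump_chain x k" using m k by (intro constant_between_jumps) auto
      then show False using before[of k] t(3) k mH by auto
    qed
    then show "ennreal (jump_time x H) \<le> s" using t by (auto intro: ennreal_leI)
  qed
qed

lemma traversal_time_eq_sum: "traversal_time x = (\<Sum>k<H. ennreal (holding_time x k))"
proof -
  have "jump_time x m = (\<Sum>k<m. holding_time x k)" for m
    by (induction m) (simp_all add: holding_time_def del: jump_time.simps(2))
  then show ?thesis
    using less_imp_le[OF hold_pos] by (simp add: traversal_time_eq_jump_time sum_ennreal)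
qed

sublocale staircase "\<lambda>k. nat (fst (jump_chain x k))" "\<lambda>k. nat (snd (jump_chain x k))" H
proof
  show "nat (snd (jump_chain x 0)) = 0" by (simp add: start)
  show "nat (fst (jump_chain x H)) = 0" by (simp add: hit)
  fix k assume k: "k < H"
  show "nat (fst (jump_chain x (Suc k))) = nat (fst (jump_chain x k)) \<and>
      nat (snd (jump_chain x (Suc k))) = Suc (nat (snd (jump_chain x k))) \<or>
      nat (fst (jump_chain x k)) = Suc (nat (fst (jump_chain x (Suc k)))) \<and>
      nat (snd (jump_chain x (Suc k))) = nat (snd (jump_chain x k))"
    using steps[of k] fst_pos[OF k] nonneg[of k] k
    by (auto simp: urn_step_def urn_up_def urn_left_def sgn_if)
qed

lemma traversal_region_eq: "traversal_region x = region"
proof -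
  have "{k. ennreal (jump_time x k) < traversal_time x} = {..<H}"
    using jump_time_nonneg strict_mono_less[OF jump_time_strict_mono]
    by (auto simp: traversal_time_eq_jump_time ennreal_less_iff)
  moreover have "lattice_point (jump_chain x k) = (real (nat (fst (jump_chain x k))), real (nat (snd (jump_chain x k))))"
    if "k \<le> H" for k
    using nonneg[OF that] by (simp add: lattice_point_def map_prod_def split_beta)
  ultimately have "traversal_path x = stairs"
    unfolding traversal_path_def stairs_def by (intro SUP_cong) auto
  then show ?thesis by (simp add: traversal_region_def region_def axes_def)
qed

lemma traversal_area_eq_sum:
  "traversal_area x = (\<Sum>k<H. ennreal (real_of_int
     (fst (jump_chain x k) * (snd (jump_chain x (Suc k)) - snd (jump_chain x k)))))"
proof -
  have "real (nat (fst (jump_chain x k))) * real (nat (snd (jump_chain x (Suc k))) - nat (snd (jump_chain x k)))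
      = real_of_int (fst (jump_chain x k) * (snd (jump_chain x (Suc k)) - snd (jump_chain x k)))" if "k < H" for k
    using nonneg[of k] nonneg[of "Suc k"] b_mono[of k "Suc k"] that by (simp add: of_nat_diff)
  then show ?thesis
    unfolding traversal_area_def traversal_region_eq emeasure_region by (intro sum.cong) auto
qed

end

lemma time_reward_le: "1 / real (a + b) \<le> real (max 1 a)"
proof -
  have "1 / real m \<le> 1" for m :: nat by (cases m) (auto simp: divide_le_eq_1)
  then have "1 / real (a + b) \<le> 1" .
  then show ?thesis by (simp add: le_max_iff_disj)
qed

lemma area_reward_le: "(real a)\<^sup>2 / real (a + b) \<le> real (max 1 a)"
proof (cases "a = 0")
  case False
  have "(real a)\<^sup>2 / real (a + b) \<le> (real a)\<^sup>2 / real a"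
    using False by (intro divide_left_mono) auto
  then show ?thesis using False by (simp add: power2_eq_square)
qed simp

section \<open>Cylinder events and the law of the jump chain\<close>

locale urn_process =
  fixes M :: "'w measure" and X :: "real \<Rightarrow> 'w \<Rightarrow> int \<times> int" and n :: nat
  assumes markov: "markov_jump_process M urn_states urn_rate (int n, 0) X" and n: "n \<ge> 1"
begin

sublocale prob_space M
  using markov by (simp add: markov_jump_process_def)

definition Y :: "nat \<Rightarrow> 'w \<Rightarrow> int \<times> int" where
  "Y k \<omega> = jump_chain (\<lambda>t. X t \<omega>) k"

definition hold :: "nat \<Rightarrow> 'w \<Rightarrow> real" where
  "hold k \<omega> = holding_time (\<lambda>t. X t \<omega>) k"

text \<open>Positivity of the holding times is built in because the given law speaks only of strict
  tails, and a holding time is an unspecified real if no further jump occurs. Thresholds 0 then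
  yield exactly these events.\<close>

definition cyl :: "(nat \<Rightarrow> int \<times> int) \<Rightarrow> nat \<Rightarrow> 'w set" where
  "cyl i k = {\<omega> \<in> space M. \<forall>j\<le>k. Y j \<omega> = i j \<and> 0 < hold j \<omega>}"

definition weight :: "(nat \<Rightarrow> int \<times> int) \<Rightarrow> nat \<Rightarrow> real" where
  "weight i k = (if i 0 = (int n, 0) then 1 else 0) * (\<Prod>j<k. urn_prob (i j) (i (Suc j)))"

lemma Y_measurable [measurable]: "Y k \<in> M \<rightarrow>\<^sub>M count_space UNIV"
proof -
  have "Y k \<in> M \<rightarrow>\<^sub>M count_space urn_states"
    using markov by (auto simp: markov_jump_process_def Y_def[abs_def])
  then show ?thesis by (rule measurable_compose[where g = "\<lambda>z. z"]) simp
qed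

lemma hold_measurable [measurable]: "hold k \<in> borel_measurable M"
  using markov by (auto simp: markov_jump_process_def hold_def[abs_def])

lemma cyl_sets [measurable]: "cyl i k \<in> sets M"
  unfolding cyl_def by measurable

lemma measure_cyl_tail:
  assumes i: "\<forall>j\<le>k. i j \<in> urn_states" and s: "0 \<le> s"
  shows "prob {\<omega> \<in> cyl i k. s < hold k \<omega>} = weight i k * exp (- exit_rate urn_states urn_rate (i k) * s)"
proof -
  define t where "t = (\<lambda>j. if j = k then s else 0)"
  have "{\<omega> \<in> cyl i k. s < hold k \<omega>} = {\<omega> \<in> space M. \<forall>j\<le>k. Y j \<omega> = i j \<and> t j < hold j \<omega>}"
    using s by (auto simp: cyl_def t_def dest: le_less_trans split: if_splits)
  also have "prob \<dots> = weight i k * (\<Prod>j\<le>k. exp (- exit_rate urn_states urn_rate (i j) * t j))"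
  proof -
    have "\<forall>j\<le>k. 0 \<le> t j" using s by (simp add: t_def)
    then show ?thesis
      using markov i unfolding markov_jump_process_def Y_def hold_def weight_def by blast
  qed
  also have "(\<Prod>j\<le>k. exp (- exit_rate urn_states urn_rate (i j) * t j))
      = (\<Prod>j\<in>{k}. exp (- exit_rate urn_states urn_rate (i j) * t j))"
    by (rule prod.mono_neutral_right) (auto simp: t_def)
  finally show ?thesis by (simp add: t_def)
qed

lemma measure_cyl:
  assumes "\<forall>j\<le>k. i j \<in> urn_states"
  shows "prob (cyl i k) = weight i k"
proof -
  have "{\<omega> \<in> cyl i k. 0 < hold k \<omega>} = cyl i k" by (auto simp: cyl_def)
  then show ?thesis using measure_cyl_tail[OF assms, of 0] by simp
qed

lemma weight_Suc: "weight (i(Suc k := z)) (Suc k) = weight i k * urn_prob (i k) z"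
proof -
  have "(\<Prod>j<k. urn_prob ((i(Suc k := z)) j) ((i(Suc k := z)) (Suc j))) = (\<Prod>j<k. urn_prob (i j) (i (Suc j)))"
    by (rule prod.cong) auto
  then show ?thesis by (simp add: weight_def)
qed

lemma upd_states:
  assumes "\<forall>j\<le>k. i j \<in> urn_states" "z \<in> urn_states"
  shows "\<forall>j\<le>Suc k. (i(Suc k := z)) j \<in> urn_states"
  using assms by (auto simp: le_Suc_eq)

lemma cyl_Suc_iff: "\<omega> \<in> cyl (i(Suc k := z)) (Suc k) \<longleftrightarrow> \<omega> \<in> cyl i k \<and> Y (Suc k) \<omega> = z \<and> 0 < hold (Suc k) \<omega>"
  by (auto simp: cyl_def le_Suc_eq)

text \<open>The two extensions are disjoint, and their probabilities add up to that of the cylinder,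
  so what they leave over is a null set.\<close>

lemma AE_cyl_Suc:
  assumes i: "\<forall>j\<le>k. i j \<in> urn_states"
  shows "AE \<omega> in M. \<omega> \<in> cyl i k \<longrightarrow> 0 < hold (Suc k) \<omega> \<and> urn_step (i k) (Y (Suc k) \<omega>)"
proof -
  let ?u = "cyl (i(Suc k := urn_up (i k))) (Suc k)" and ?l = "cyl (i(Suc k := urn_left (i k))) (Suc k)"
  have z: "i k \<in> urn_states" using i by simp
  have disj: "?u \<inter> ?l = {}" using urn_up_neq_left[OF z] by (auto simp: cyl_Suc_iff)
  have sub: "?u \<union> ?l \<subseteq> cyl i k" by (auto simp: cyl_Suc_iff)
  have mu: "prob ?u = weight i k * urn_prob (i k) (urn_up (i k))"
    using measure_cyl[OF upd_states[OF i urn_up_in_states[OF z]]] unfolding weight_Suc .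
  have ml: "prob ?l = weight i k * urn_prob (i k) (urn_left (i k))"
    using measure_cyl[OF upd_states[OF i urn_left_in_states[OF z]]] unfolding weight_Suc .
  have "prob (cyl i k - (?u \<union> ?l)) = prob (cyl i k) - (prob ?u + prob ?l)"
    using sub disj by (subst finite_measure_Diff) (auto simp: finite_measure_Union)
  also have "\<dots> = 0"
    using urn_prob_up_left_sum[OF z] by (simp add: measure_cyl[OF i] mu ml distrib_left[symmetric])
  finally have "AE \<omega> in M. \<omega> \<notin> cyl i k - (?u \<union> ?l)"
    by (intro AE_not_in) (auto simp: null_sets_def emeasure_eq_measure)
  \<comment> \<open>On an axis one extension does not move. It has probability 0, which gives the
    side conditions of \<open>urn_step\<close>.\<close>
  moreover have "AE \<omega> in M. fst (i k) = 0 \<longrightarrow> \<omega> \<notin> ?u"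
  proof (cases "fst (i k) = 0")
    case True
    then have "prob ?u = 0" using mu by (simp add: urn_prob_up[OF z])
    then have "?u \<in> null_sets M" by (simp add: null_sets_def emeasure_eq_measure)
    from AE_not_in[OF this] show ?thesis by eventually_elim simp
  qed simp
  moreover have "AE \<omega> in M. snd (i k) = 0 \<longrightarrow> \<omega> \<notin> ?l"
  proof (cases "snd (i k) = 0")
    case True
    then have "prob ?l = 0" using ml by (simp add: urn_prob_left[OF z])
    then have "?l \<in> null_sets M" by (simp add: null_sets_def emeasure_eq_measure)
    from AE_not_in[OF this] show ?thesis by eventually_elim simp
  qed simp
  ultimately show ?thesis
    by eventually_elim (auto simp: cyl_Suc_iff urn_step_def)
qed

lemma AE_start: "AE \<omega> in M. \<omega> \<in> cyl (\<lambda>_. (int n, 0)) 0"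
proof -
  have "prob (cyl (\<lambda>_. (int n, 0)) 0) = 1"
    using n by (subst measure_cyl) (auto simp: weight_def)
  then show ?thesis by (subst prob_eq_1[symmetric]) auto
qed

text \<open>The induction runs forward from an arbitrary history. Each step branches into only two
  histories, so finitely many null sets are joined for each K, and countably many in all.\<close>

lemma AE_path:
  "AE \<omega> in M. Y 0 \<omega> = (int n, 0) \<and> (\<forall>k. 0 < hold k \<omega> \<and> urn_step (Y k \<omega>) (Y (Suc k) \<omega>))"
proof -
  have "AE \<omega> in M. \<omega> \<in> cyl i k \<longrightarrow> (\<forall>j<K. 0 < hold (Suc (k + j)) \<omega> \<and> urn_step (Y (k + j) \<omega>) (Y (Suc (k + j)) \<omega>))"
    if "\<forall>j\<le>k. i j \<in> urn_states" for K i k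
    using that
  proof (induction K arbitrary: i k)
    case (Suc K)
    have "AE \<omega> in M. \<omega> \<in> cyl (i(Suc k := z)) (Suc k) \<longrightarrow>
        (\<forall>j<K. 0 < hold (Suc (Suc k + j)) \<omega> \<and> urn_step (Y (Suc k + j) \<omega>) (Y (Suc (Suc k + j)) \<omega>))"
      if "z \<in> {urn_up (i k), urn_left (i k)}" for z
    proof -
      have "i k \<in> urn_states" using Suc.prems by blast
      from urn_up_in_states[OF this] urn_left_in_states[OF this] that
      have "z \<in> urn_states" by (elim insertE) (simp_all only: empty_iff)
      then show ?thesis by (intro Suc.IH upd_states Suc.prems)
    qed
    then have "AE \<omega> in M. \<forall>z\<in>{urn_up (i k), urn_left (i k)}. \<omega> \<in> cyl (i(Suc k := z)) (Suc k) \<longrightarrow>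
        (\<forall>j<K. 0 < hold (Suc (Suc k + j)) \<omega> \<and> urn_step (Y (Suc k + j) \<omega>) (Y (Suc (Suc k + j)) \<omega>))"
      by (intro AE_finite_allI) auto
    with AE_cyl_Suc[OF Suc.prems] show ?case
    proof eventually_elim
      case (elim \<omega>)
      show ?case
      proof (intro impI allI)
        fix j assume c: "\<omega> \<in> cyl i k" and j: "j < Suc K"
        then have h: "0 < hold (Suc k) \<omega>" "urn_step (i k) (Y (Suc k) \<omega>)" using elim by auto
        have Yk: "Y k \<omega> = i k" using c by (auto simp: cyl_def)
        have "Y (Suc k) \<omega> \<in> {urn_up (i k), urn_left (i k)}" using h by (auto simp: urn_step_def)
        moreover have "\<omega> \<in> cyl (i(Suc k := Y (Suc k) \<omega>)) (Suc k)" using c h by (simp add: cyl_Suc_iff)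
        ultimately have rest: "\<forall>j<K. 0 < hold (Suc (Suc k + j)) \<omega> \<and> urn_step (Y (Suc k + j) \<omega>) (Y (Suc (Suc k + j)) \<omega>)"
          using elim by blast
        show "0 < hold (Suc (k + j)) \<omega> \<and> urn_step (Y (k + j) \<omega>) (Y (Suc (k + j)) \<omega>)"
        proof (cases j)
          case 0
          then show ?thesis using h Yk by simp
        next
          case (Suc j')
          then show ?thesis using rest[rule_format, of j'] j by simp
        qed
      qed
    qed
  qed simp
  from this[of 0 "\<lambda>_. (int n, 0)"] n
  have "AE \<omega> in M. \<forall>K. \<omega> \<in> cyl (\<lambda>_. (int n, 0)) 0 \<longrightarrow>
      (\<forall>j<K. 0 < hold (Suc (0 + j)) \<omega> \<and> urn_step (Y (0 + j) \<omega>) (Y (Suc (0 + j)) \<omega>))"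
    by (subst AE_all_countable) auto
  with AE_start show ?thesis
  proof eventually_elim
    case (elim \<omega>)
    then have "0 < hold (Suc k) \<omega> \<and> urn_step (Y k \<omega>) (Y (Suc k) \<omega>)" for k
      by (metis add_0 lessI)
    moreover have "Y 0 \<omega> = (int n, 0)" "0 < hold 0 \<omega>" using elim by (auto simp: cyl_def)
    ultimately show ?case by (metis not0_implies_Suc)
  qed
qed

text \<open>Conditioning on the next state; this plays the part of the Markov property.\<close>

lemma nn_integral_cyl_split:
  assumes i: "\<forall>j\<le>k. i j \<in> urn_states" and f [measurable]: "f \<in> borel_measurable M"
  shows "(\<integral>\<^sup>+\<omega>. f \<omega> * indicator (cyl i k) \<omega> \<partial>M)
    = (\<integral>\<^sup>+\<omega>. f \<omega> * indicator (cyl (i(Suc k := urn_up (i k))) (Suc k)) \<omega> \<partial>M)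
    + (\<integral>\<^sup>+\<omega>. f \<omega> * indicator (cyl (i(Suc k := urn_left (i k))) (Suc k)) \<omega> \<partial>M)"
proof -
  have z: "i k \<in> urn_states" using i by simp
  have "(\<integral>\<^sup>+\<omega>. f \<omega> * indicator (cyl i k) \<omega> \<partial>M)
    = (\<integral>\<^sup>+\<omega>. f \<omega> * indicator (cyl (i(Suc k := urn_up (i k))) (Suc k)) \<omega>
        + f \<omega> * indicator (cyl (i(Suc k := urn_left (i k))) (Suc k)) \<omega> \<partial>M)"
    using AE_cyl_Suc[OF i] urn_up_neq_left[OF z]
    by (intro nn_integral_cong_AE, elim AE_mp, intro AE_I2)
      (auto simp: cyl_Suc_iff urn_step_def indicator_def)
  also have "\<dots> = (\<integral>\<^sup>+\<omega>. f \<omega> * indicator (cyl (i(Suc k := urn_up (i k))) (Suc k)) \<omega> \<partial>M)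
    + (\<integral>\<^sup>+\<omega>. f \<omega> * indicator (cyl (i(Suc k := urn_left (i k))) (Suc k)) \<omega> \<partial>M)"
    by (rule nn_integral_add) measurable
  finally show ?thesis .
qed

lemma weight_nonneg: "\<forall>j\<le>k. i j \<in> urn_states \<Longrightarrow> 0 \<le> weight i k"
  using measure_cyl measure_nonneg by metis

text \<open>The holding time is the integral over s of the indicator that it exceeds s. Exchanging
  integrals leaves the integral of weight * exp (- l s), which is weight / l.\<close>

lemma nn_integral_hold_cyl:
  assumes i: "\<forall>j\<le>k. i j \<in> urn_states"
  shows "(\<integral>\<^sup>+\<omega>. ennreal (hold k \<omega>) * indicator (cyl i k) \<omega> \<partial>M)
    = ennreal (weight i k / real_of_int (\<bar>fst (i k)\<bar> + \<bar>snd (i k)\<bar>))"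
proof -
  define l where "l = real_of_int (\<bar>fst (i k)\<bar> + \<bar>snd (i k)\<bar>)"
  have z: "i k \<in> urn_states" using i by simp
  have l: "l > 0"
  proof -
    have "\<bar>fst (i k)\<bar> + \<bar>snd (i k)\<bar> > 0" using z by (cases "i k") auto
    then show ?thesis by (simp only: l_def of_int_0_less_iff)
  qed
  interpret pair_sigma_finite lborel M
    by (intro pair_sigma_finite.intro sigma_finite_lborel sigma_finite_measure_axioms)
  have "(\<integral>\<^sup>+\<omega>. ennreal (hold k \<omega>) * indicator (cyl i k) \<omega> \<partial>M)
      = (\<integral>\<^sup>+\<omega>. (\<integral>\<^sup>+s. (if 0 \<le> s \<and> s < hold k \<omega> \<and> \<omega> \<in> cyl i k then 1 else 0) \<partial>lborel) \<partial>M)"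
  proof (rule nn_integral_cong)
    fix \<omega>
    show "ennreal (hold k \<omega>) * indicator (cyl i k) \<omega>
        = (\<integral>\<^sup>+s. (if 0 \<le> s \<and> s < hold k \<omega> \<and> \<omega> \<in> cyl i k then 1 else 0) \<partial>lborel)"
    proof (cases "\<omega> \<in> cyl i k")
      case True
      then have "(\<integral>\<^sup>+s. (if 0 \<le> s \<and> s < hold k \<omega> \<and> \<omega> \<in> cyl i k then 1 else 0) \<partial>lborel)
          = (\<integral>\<^sup>+s. indicator {0..<hold k \<omega>} s \<partial>lborel)"
        by (intro nn_integral_cong) (auto simp: indicator_def)
      moreover have "0 < hold k \<omega>" using True by (auto simp: cyl_def)
      ultimately show ?thesis using True by simp
    qed simp
  qed
  also have "\<dots> = (\<integral>\<^sup>+s. (\<integral>\<^sup>+\<omega>. (if 0 \<le> s \<and> s < hold k \<omega> \<and> \<omega> \<in> cyl i k then 1 else 0) \<partial>M) \<partial>lborel)"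
    by (rule Fubini') measurable
  also have "\<dots> = (\<integral>\<^sup>+s. ennreal (weight i k * exp (- l * s)) * indicator {0..} s \<partial>lborel)"
  proof (rule nn_integral_cong)
    fix s :: real
    show "(\<integral>\<^sup>+\<omega>. (if 0 \<le> s \<and> s < hold k \<omega> \<and> \<omega> \<in> cyl i k then 1 else 0) \<partial>M)
        = ennreal (weight i k * exp (- l * s)) * indicator {0..} s"
    proof (cases "0 \<le> s")
      case True
      have [measurable]: "{\<omega> \<in> cyl i k. s < hold k \<omega>} \<in> sets M"
      proof -
        have "{\<omega> \<in> cyl i k. s < hold k \<omega>} = cyl i k \<inter> {\<omega> \<in> space M. s < hold k \<omega>}"
          using sets.sets_into_space[OF cyl_sets] by blast
        then show ?thesis by simp
      qed
      have "(\<integral>\<^sup>+\<omega>. (if 0 \<le> s \<and> s < hold k \<omega> \<and> \<omega> \<in> cyl i k then 1 else 0) \<partial>M)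
          = (\<integral>\<^sup>+\<omega>. indicator {\<omega> \<in> cyl i k. s < hold k \<omega>} \<omega> \<partial>M)"
        using True by (intro nn_integral_cong) (auto simp: indicator_def)
      also have "\<dots> = ennreal (prob {\<omega> \<in> cyl i k. s < hold k \<omega>})"
        by (simp add: emeasure_eq_measure)
      finally show ?thesis using True measure_cyl_tail[OF i True] exit_rate_urn[OF z] by (simp add: l_def)
    qed simp
  qed
  also have "\<dots> = ennreal (0 - (- weight i k / l * exp (- l * 0)))"
  proof (rule nn_integral_FTC_atLeast)
    fix x :: real
    show "((\<lambda>x. - weight i k / l * exp (- l * x)) has_real_derivative weight i k * exp (- l * x)) (at x)"
      using l by (auto intro!: derivative_eq_intros)
    show "0 \<le> weight i k * exp (- l * x)" using weight_nonneg[OF i] by simp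
  next
    have "LIM x at_top. - l * x :> at_bot"
      using l by (intro filterlim_tendsto_neg_mult_at_bot[OF tendsto_const] filterlim_ident) auto
    then have "((\<lambda>x. exp (- l * x)) \<longlongrightarrow> 0) at_top"
      using exp_at_bot filterlim_compose by blast
    then show "((\<lambda>x. - weight i k / l * exp (- l * x)) \<longlongrightarrow> 0) at_top"
      by (rule tendsto_mult_right_zero)
  qed auto
  finally show ?thesis by (simp add: l_def)
qed

section \<open>Accumulated rewards and their expectations\<close>

primrec reward :: "(nat \<Rightarrow> 'w \<Rightarrow> ennreal) \<Rightarrow> nat \<Rightarrow> nat \<Rightarrow> 'w \<Rightarrow> ennreal" where
  "reward r 0 k \<omega> = 0"
| "reward r (Suc K) k \<omega> = (if 0 < fst (Y k \<omega>) then r k \<omega> + reward r K (Suc k) \<omega> else 0)"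

lemma reward_measurable:
  assumes [measurable]: "\<And>k. r k \<in> borel_measurable M"
  shows "reward r K k \<in> borel_measurable M"
proof (induction K arbitrary: k)
  case 0
  then show ?case by simp
next
  case (Suc K)
  have [measurable]: "reward r K (Suc k) \<in> borel_measurable M" by (rule Suc)
  have [measurable]: "Measurable.pred M (\<lambda>\<omega>. 0 < fst (Y k \<omega>))"
    by (rule measurable_compose[OF Y_measurable]) simp
  have "(\<lambda>\<omega>. if 0 < fst (Y k \<omega>) then r k \<omega> + reward r K (Suc k) \<omega> else 0) \<in> borel_measurable M"
    by measurable
  then show ?case by (simp cong: measurable_cong)
qed

lemma reward_mono: "reward r K k \<omega> \<le> reward r (Suc K) k \<omega>"
proof (induction K arbitrary: k)
  case 0
  then show ?case by simp
next
  case (Suc K)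
  show ?case
    unfolding reward.simps(2)[of r K k \<omega>] reward.simps(2)[of r "Suc K" k \<omega>]
    using Suc by (auto simp del: reward.simps)
qed

text \<open>\<open>mean\<close> says that, given the history, the reward of jump k has mean
  \<open>\<rho> a b\<close>. It may depend on the next state as well, as the area does. The
  recursion peels off the first jump, so the induction must range over all histories.\<close>

lemma nn_integral_reward_cyl:
  assumes r [measurable]: "\<And>k. r k \<in> borel_measurable M" and \<rho>: "\<And>a b. 0 \<le> \<rho> a b"
    and mean: "\<And>i k a b. \<forall>j\<le>k. i j \<in> urn_states \<Longrightarrow> i k = (int a, int b) \<Longrightarrow> a \<ge> 1 \<Longrightarrow>
      (\<integral>\<^sup>+\<omega>. r k \<omega> * indicator (cyl i k) \<omega> \<partial>M) = ennreal (weight i k * \<rho> a b)"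
    and i: "\<forall>j\<le>k. i j \<in> urn_states" and ik: "i k = (int a, int b)"
  shows "(\<integral>\<^sup>+\<omega>. reward r K k \<omega> * indicator (cyl i k) \<omega> \<partial>M) = ennreal (weight i k * urn_value \<rho> K a b)"
  using i ik
proof (induction K arbitrary: i k a b)
  case 0
  then show ?case by simp
next
  case (Suc K)
  note [measurable] = reward_measurable[OF r]
  note i = Suc.prems(1)
  have Yk: "Y k \<omega> = (int a, int b)" if "\<omega> \<in> cyl i k" for \<omega>
    using that Suc.prems by (auto simp: cyl_def)
  have val: "0 \<le> urn_value \<rho> K a b" for a b
    by (induction K arbitrary: a b) (auto simp: \<rho>)
  show ?case
  proof (cases "a = 0")
    case True
    have "(\<integral>\<^sup>+\<omega>. reward r (Suc K) k \<omega> * indicator (cyl i k) \<omega> \<partial>M) = (\<integral>\<^sup>+\<omega>. 0 \<partial>M)"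
      using Yk True by (intro nn_integral_cong) (auto simp: indicator_def)
    then show ?thesis using True by simp
  next
    case False
    have z: "i k \<in> urn_states" using i by simp
    have up: "urn_up (i k) = (int a, int (Suc b))" using False Suc.prems by (simp add: urn_up_def)
    let ?u = "i(Suc k := urn_up (i k))" and ?l = "i(Suc k := urn_left (i k))"
    have wu: "weight ?u (Suc k) = weight i k * (real a / real (a + b))"
      unfolding weight_Suc urn_prob_up[OF z] by (simp add: Suc.prems)
    have wl: "weight ?l (Suc k) = weight i k * (real b / real (a + b))"
      unfolding weight_Suc urn_prob_left[OF z] by (simp add: Suc.prems)
    have "(\<integral>\<^sup>+\<omega>. reward r (Suc K) k \<omega> * indicator (cyl i k) \<omega> \<partial>M)
      = (\<integral>\<^sup>+\<omega>. r k \<omega> * indicator (cyl i k) \<omega> + reward r K (Suc k) \<omega> * indicator (cyl i k) \<omega> \<partial>M)"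
      using Yk False by (intro nn_integral_cong) (auto simp: indicator_def)
    also have "\<dots> = (\<integral>\<^sup>+\<omega>. r k \<omega> * indicator (cyl i k) \<omega> \<partial>M)
        + (\<integral>\<^sup>+\<omega>. reward r K (Suc k) \<omega> * indicator (cyl i k) \<omega> \<partial>M)"
      by (rule nn_integral_add) measurable
    also have "(\<integral>\<^sup>+\<omega>. r k \<omega> * indicator (cyl i k) \<omega> \<partial>M) = ennreal (weight i k * \<rho> a b)"
      using False Suc.prems by (intro mean) auto
    also have "(\<integral>\<^sup>+\<omega>. reward r K (Suc k) \<omega> * indicator (cyl i k) \<omega> \<partial>M)
        = (\<integral>\<^sup>+\<omega>. reward r K (Suc k) \<omega> * indicator (cyl ?u (Suc k)) \<omega> \<partial>M)
        + (\<integral>\<^sup>+\<omega>. reward r K (Suc k) \<omega> * indicator (cyl ?l (Suc k)) \<omega> \<partial>M)"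
      by (rule nn_integral_cyl_split[OF i]) measurable
    also have "(\<integral>\<^sup>+\<omega>. reward r K (Suc k) \<omega> * indicator (cyl ?u (Suc k)) \<omega> \<partial>M)
        = ennreal (weight ?u (Suc k) * urn_value \<rho> K a (Suc b))"
      using up by (intro Suc.IH upd_states[OF i urn_up_in_states[OF z]]) simp
    also have "(\<integral>\<^sup>+\<omega>. reward r K (Suc k) \<omega> * indicator (cyl ?l (Suc k)) \<omega> \<partial>M)
        = ennreal (weight ?l (Suc k) * urn_value \<rho> K (a - 1) b)"
    \<comment> \<open>In row 0 \<open>urn_left\<close> stays at (a, 0) instead of reaching (a - 1,
      0), but this extension has weight 0.\<close>
    proof (cases "b = 0")
      case True
      then have "urn_left (i k) = (int a, int 0)" using Suc.prems by (simp add: urn_left_def)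
      then have "(\<integral>\<^sup>+\<omega>. reward r K (Suc k) \<omega> * indicator (cyl ?l (Suc k)) \<omega> \<partial>M)
        = ennreal (weight ?l (Suc k) * urn_value \<rho> K a 0)"
        by (intro Suc.IH upd_states[OF i urn_left_in_states[OF z]]) simp
      then show ?thesis using True wl by simp
    next
      case b: False
      then have "urn_left (i k) = (int (a - 1), int b)"
        using False Suc.prems by (simp add: urn_left_def of_nat_diff)
      then show ?thesis
        by (intro Suc.IH upd_states[OF i urn_left_in_states[OF z]]) simp
    qed
    finally have "(\<integral>\<^sup>+\<omega>. reward r (Suc K) k \<omega> * indicator (cyl i k) \<omega> \<partial>M)
      = ennreal (weight i k * \<rho> a b) + (ennreal (weight ?u (Suc k) * urn_value \<rho> K a (Suc b))
        + ennreal (weight ?l (Suc k) * urn_value \<rho> K (a - 1) b))" .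
    also have "\<dots> = ennreal (weight i k * \<rho> a b + (weight ?u (Suc k) * urn_value \<rho> K a (Suc b)
        + weight ?l (Suc k) * urn_value \<rho> K (a - 1) b))"
      using weight_nonneg[OF i] \<rho> val unfolding wu wl by (simp add: ennreal_plus del: urn_value.simps)
    also have "\<dots> = ennreal (weight i k * urn_value \<rho> (Suc K) a b)"
      unfolding wu wl using False by (simp add: algebra_simps)
    finally show ?thesis .
  qed
qed

lemma nn_integral_SUP_reward:
  assumes r: "\<And>k. r k \<in> borel_measurable M" and \<rho>: "\<And>a b. 0 \<le> \<rho> a b"
    and \<rho>_le: "\<And>a b. \<rho> a b \<le> real (max 1 a)"
    and mean: "\<And>i k a b. \<forall>j\<le>k. i j \<in> urn_states \<Longrightarrow> i k = (int a, int b) \<Longrightarrow> a \<ge> 1 \<Longrightarrow>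
      (\<integral>\<^sup>+\<omega>. r k \<omega> * indicator (cyl i k) \<omega> \<partial>M) = ennreal (weight i k * \<rho> a b)"
  shows "(\<integral>\<^sup>+\<omega>. (SUP K. reward r K 0 \<omega>) \<partial>M) = ennreal (urn_limit \<rho> n 0)"
proof -
  let ?i = "\<lambda>_::nat. (int n, 0::int)"
  have i: "\<forall>j\<le>0. ?i j \<in> urn_states" using n by simp
  have val: "(\<integral>\<^sup>+\<omega>. reward r K 0 \<omega> \<partial>M) = ennreal (urn_value \<rho> K n 0)" for K
  proof -
    have "(\<integral>\<^sup>+\<omega>. reward r K 0 \<omega> \<partial>M) = (\<integral>\<^sup>+\<omega>. reward r K 0 \<omega> * indicator (cyl ?i 0) \<omega> \<partial>M)"
      using AE_start by (intro nn_integral_cong_AE) (auto simp: indicator_def elim: eventually_mono)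
    also have "\<dots> = ennreal (weight ?i 0 * urn_value \<rho> K n 0)"
      by (rule nn_integral_reward_cyl[OF r \<rho> mean i]) auto
    finally show ?thesis by (simp add: weight_def)
  qed
  have "(\<integral>\<^sup>+\<omega>. (SUP K. reward r K 0 \<omega>) \<partial>M) = (SUP K. \<integral>\<^sup>+\<omega>. reward r K 0 \<omega> \<partial>M)"
    by (intro nn_integral_monotone_convergence_SUP reward_measurable r incseq_SucI le_funI reward_mono)
  also have "\<dots> = (SUP K. ennreal (urn_value \<rho> K n 0))" by (simp add: val)
  also have "\<dots> = ennreal (urn_limit \<rho> n 0)"
  proof (rule LIMSEQ_unique)
    show "(\<lambda>K. ennreal (urn_value \<rho> K n 0)) \<longlonglongrightarrow> (SUP K. ennreal (urn_value \<rho> K n 0))"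
      by (intro LIMSEQ_SUP incseq_SucI ennreal_leI urn_value_mono[OF \<rho> \<rho>_le])
    show "(\<lambda>K. ennreal (urn_value \<rho> K n 0)) \<longlonglongrightarrow> ennreal (urn_limit \<rho> n 0)"
      using urn_value_tendsto[OF \<rho> \<rho>_le] by (rule tendsto_ennrealI)
  qed
  finally show ?thesis .
qed

lemma reward_eq_sum:
  assumes "\<And>k. k < H \<Longrightarrow> 0 < fst (Y k \<omega>)" "fst (Y H \<omega>) = 0" "k \<le> H"
  shows "reward r K k \<omega> = (\<Sum>j=k..<min (k + K) H. r j \<omega>)"
  using assms(3)
proof (induction K arbitrary: k)
  case 0
  then show ?case by simp
next
  case (Suc K)
  show ?case
  proof (cases "k = H")
    case True
    then show ?thesis using assms(2) by simp
  next
    case False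
    then have "(\<Sum>j=k..<min (k + Suc K) H. r j \<omega>) = r k \<omega> + (\<Sum>j=Suc k..<min (Suc k + K) H. r j \<omega>)"
      using Suc.prems by (subst sum.atLeast_Suc_lessThan) auto
    then show ?thesis using Suc.IH[of "Suc k"] Suc.prems False assms(1)[of k] by simp
  qed
qed

lemma SUP_reward_eq_sum:
  assumes "\<And>k. k < H \<Longrightarrow> 0 < fst (Y k \<omega>)" "fst (Y H \<omega>) = 0"
  shows "(SUP K. reward r K 0 \<omega>) = (\<Sum>j<H. r j \<omega>)"
proof (rule antisym)
  show "(SUP K. reward r K 0 \<omega>) \<le> (\<Sum>j<H. r j \<omega>)"
    using reward_eq_sum[OF assms, of 0]
    by (intro SUP_least) (auto simp: atLeast0LessThan intro!: sum_mono2)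
  have "(\<Sum>j<H. r j \<omega>) = reward r H 0 \<omega>"
    using reward_eq_sum[OF assms, of 0] by (simp add: atLeast0LessThan)
  also have "\<dots> \<le> (SUP K. reward r K 0 \<omega>)" by (rule SUP_upper) simp
  finally show "(\<Sum>j<H. r j \<omega>) \<le> (SUP K. reward r K 0 \<omega>)" .
qed

text \<open>With reward 1 the total counts the jumps before the hit. Its mean is finite, while on a
  path that never hits it is infinite.\<close>

lemma AE_hit: "AE \<omega> in M. \<exists>k. fst (Y k \<omega>) = 0"
proof -
  have "(\<integral>\<^sup>+\<omega>. (SUP K. reward (\<lambda>_ _. 1) K 0 \<omega>) \<partial>M) = ennreal (urn_limit (\<lambda>_ _. 1) n 0)"
    by (rule nn_integral_SUP_reward) (auto simp: measure_cyl emeasure_eq_measure)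
  moreover have "(\<lambda>\<omega>. SUP K. reward (\<lambda>_ _. 1) K 0 \<omega>) \<in> borel_measurable M"
    by (intro borel_measurable_SUP reward_measurable) auto
  ultimately have "AE \<omega> in M. (SUP K. reward (\<lambda>_ _. 1) K 0 \<omega>) \<noteq> \<infinity>"
    by (intro nn_integral_PInf_AE) auto
  with AE_path show ?thesis
  proof eventually_elim
    case (elim \<omega>)
    show ?case
    proof (rule ccontr)
      assume never: "\<nexists>k. fst (Y k \<omega>) = 0"
      have pos: "0 < fst (Y k \<omega>) \<and> 0 \<le> snd (Y k \<omega>)" for k
      proof (induction k)
        case 0
        then show ?case using elim n by simp
      next
        case (Suc k)
        have "urn_step (Y k \<omega>) (Y (Suc k) \<omega>)" "fst (Y (Suc k) \<omega>) \<noteq> 0" using elim never by auto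
        then show ?case using Suc by (auto simp: urn_step_def urn_up_def urn_left_def sgn_if split: if_splits)
      qed
      have "reward (\<lambda>_ _. 1) K k \<omega> = of_nat K" for K k
        by (induction K arbitrary: k) (auto simp: pos)
      then have "(SUP K. reward (\<lambda>_ _. 1) K 0 \<omega>) = \<infinity>" by (simp add: ennreal_SUP_of_nat_eq_top)
      then show False using elim by simp
    qed
  qed
qed

lemma AE_urn_path: "AE \<omega> in M. \<exists>H. urn_path (\<lambda>t. X t \<omega>) n H"
  using AE_path AE_hit
proof eventually_elim
  case (elim \<omega>)
  define H where "H = (LEAST k. fst (Y k \<omega>) = 0)"
  have "fst (Y H \<omega>) = 0" unfolding H_def using elim(2) by (rule LeastI_ex)
  moreover have "fst (Y k \<omega>) \<noteq> 0" if "k < H" for k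
    using not_less_Least[OF that[unfolded H_def]] .
  ultimately have "urn_path (\<lambda>t. X t \<omega>) n H"
    using elim(1) unfolding urn_path_def Y_def hold_def by auto
  then show ?case by blast
qed

section \<open>Expected traversal time and area as limits of the iteration\<close>

lemma expected_time:
  "(\<integral>\<^sup>+\<omega>. traversal_time (\<lambda>t. X t \<omega>) \<partial>M) = ennreal (urn_limit (\<lambda>a b. 1 / real (a + b)) n 0)"
proof -
  let ?r = "\<lambda>k \<omega>. ennreal (hold k \<omega>)"
  have "(\<integral>\<^sup>+\<omega>. traversal_time (\<lambda>t. X t \<omega>) \<partial>M) = (\<integral>\<^sup>+\<omega>. (SUP K. reward ?r K 0 \<omega>) \<partial>M)"
  proof (rule nn_integral_cong_AE, use AE_urn_path in eventually_elim)
    case (elim \<omega>)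
    then obtain H where "urn_path (\<lambda>t. X t \<omega>) n H" by blast
    then interpret urn_path "\<lambda>t. X t \<omega>" n H .
    have "(SUP K. reward ?r K 0 \<omega>) = (\<Sum>j<H. ?r j \<omega>)"
      by (rule SUP_reward_eq_sum) (use fst_pos hit in \<open>auto simp: Y_def\<close>)
    then show ?case by (simp add: traversal_time_eq_sum hold_def)
  qed
  also have "\<dots> = ennreal (urn_limit (\<lambda>a b. 1 / real (a + b)) n 0)"
  proof (rule nn_integral_SUP_reward)
    fix i :: "nat \<Rightarrow> int \<times> int" and k a b
    assume "\<forall>j\<le>k. i j \<in> urn_states" "i k = (int a, int b)"
    then show "(\<integral>\<^sup>+\<omega>. ?r k \<omega> * indicator (cyl i k) \<omega> \<partial>M) = ennreal (weight i k * (1 / real (a + b)))"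
      by (subst nn_integral_hold_cyl) auto
  next
    fix a b :: nat
    show "1 / real (a + b) \<le> real (max 1 a)" by (rule time_reward_le)
  qed auto
  finally show ?thesis .
qed

text \<open>The strip added by jump k has area a if the jump goes up, with probability a/(a + b),
  and 0 if it goes left, so its mean is a^2/(a + b).\<close>

lemma expected_area:
  "(\<integral>\<^sup>+\<omega>. traversal_area (\<lambda>t. X t \<omega>) \<partial>M) = ennreal (urn_limit (\<lambda>a b. (real a)\<^sup>2 / real (a + b)) n 0)"
proof -
  let ?r = "\<lambda>k \<omega>. ennreal (real_of_int (fst (Y k \<omega>) * (snd (Y (Suc k) \<omega>) - snd (Y k \<omega>))))"
  have r [measurable]: "?r k \<in> borel_measurable M" for k
  proof -
    have "(\<lambda>\<omega>. real_of_int (fst (Y j \<omega>))) \<in> borel_measurable M"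
      "(\<lambda>\<omega>. real_of_int (snd (Y j \<omega>))) \<in> borel_measurable M" for j
      by (rule measurable_compose[OF Y_measurable]; simp)+
    note [measurable] = this
    show ?thesis unfolding of_int_mult of_int_diff by measurable
  qed
  have "(\<integral>\<^sup>+\<omega>. traversal_area (\<lambda>t. X t \<omega>) \<partial>M) = (\<integral>\<^sup>+\<omega>. (SUP K. reward ?r K 0 \<omega>) \<partial>M)"
  proof (rule nn_integral_cong_AE, use AE_urn_path in eventually_elim)
    case (elim \<omega>)
    then obtain H where "urn_path (\<lambda>t. X t \<omega>) n H" by blast
    then interpret urn_path "\<lambda>t. X t \<omega>" n H .
    have "(SUP K. reward ?r K 0 \<omega>) = (\<Sum>j<H. ?r j \<omega>)"
      by (rule SUP_reward_eq_sum) (use fst_pos hit in \<open>auto simp: Y_def\<close>)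
    then show ?case by (simp only: traversal_area_eq_sum Y_def)
  qed
  also have "\<dots> = ennreal (urn_limit (\<lambda>a b. (real a)\<^sup>2 / real (a + b)) n 0)"
  proof (rule nn_integral_SUP_reward[OF r])
    fix i :: "nat \<Rightarrow> int \<times> int" and k a b :: nat
    assume i: "\<forall>j\<le>k. i j \<in> urn_states" and ik: "i k = (int a, int b)" and a: "a \<ge> 1"
    have z: "i k \<in> urn_states" using i by simp
    let ?u = "i(Suc k := urn_up (i k))" and ?l = "i(Suc k := urn_left (i k))"
    have Yk: "Y k \<omega> = (int a, int b)" if "\<omega> \<in> cyl i k" for \<omega> using that ik by (auto simp: cyl_def)
    have "(\<integral>\<^sup>+\<omega>. ?r k \<omega> * indicator (cyl i k) \<omega> \<partial>M)
        = (\<integral>\<^sup>+\<omega>. ?r k \<omega> * indicator (cyl ?u (Suc k)) \<omega> \<partial>M) + (\<integral>\<^sup>+\<omega>. ?r k \<omega> * indicator (cyl ?l (Suc k)) \<omega> \<partial>M)"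
      by (rule nn_integral_cyl_split[OF i r])
    also have "(\<integral>\<^sup>+\<omega>. ?r k \<omega> * indicator (cyl ?u (Suc k)) \<omega> \<partial>M)
        = (\<integral>\<^sup>+\<omega>. ennreal (real a) * indicator (cyl ?u (Suc k)) \<omega> \<partial>M)"
      using a by (intro nn_integral_cong) (auto simp: indicator_def cyl_Suc_iff Yk urn_up_def ik)
    also have "\<dots> = ennreal (real a) * ennreal (prob (cyl ?u (Suc k)))"
      by (simp add: nn_integral_cmult emeasure_eq_measure)
    also have "prob (cyl ?u (Suc k)) = weight i k * (real a / real (a + b))"
      unfolding measure_cyl[OF upd_states[OF i urn_up_in_states[OF z]]] weight_Suc urn_prob_up[OF z]
      by (simp add: ik)
    also have "(\<integral>\<^sup>+\<omega>. ?r k \<omega> * indicator (cyl ?l (Suc k)) \<omega> \<partial>M) = (\<integral>\<^sup>+\<omega>. 0 \<partial>M)"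
      by (intro nn_integral_cong) (auto simp: indicator_def cyl_Suc_iff Yk urn_left_def ik)
    finally have "(\<integral>\<^sup>+\<omega>. ?r k \<omega> * indicator (cyl i k) \<omega> \<partial>M)
        = ennreal (real a) * ennreal (weight i k * (real a / real (a + b)))" by simp
    also have "\<dots> = ennreal (real a * (weight i k * (real a / real (a + b))))"
      using weight_nonneg[OF i] by (intro ennreal_mult[symmetric]) auto
    also have "real a * (weight i k * (real a / real (a + b))) = weight i k * ((real a)\<^sup>2 / real (a + b))"
      by (simp add: power2_eq_square)
    finally show "(\<integral>\<^sup>+\<omega>. ?r k \<omega> * indicator (cyl i k) \<omega> \<partial>M)
        = ennreal (weight i k * ((real a)\<^sup>2 / real (a + b)))" .
  next
    fix a b :: nat
    show "(real a)\<^sup>2 / real (a + b) \<le> real (max 1 a)" by (rule area_reward_le)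
  qed auto
  finally show ?thesis .
qed

end

theorem theorem2p15:
  fixes M :: "nat \<Rightarrow> 'w measure"
    and A B :: "nat \<Rightarrow> real \<Rightarrow> 'w \<Rightarrow> int"
    and E_area E_time :: "nat \<Rightarrow> ennreal"
  assumes fast: "\<And>n. n \<ge> 1 \<Longrightarrow> fast_embedding (M n) (int n, 0) (A n) (B n)"
  defines "E_area \<equiv> \<lambda>n. \<integral>\<^sup>+\<omega>. traversal_area (\<lambda>t. (A n t \<omega>, B n t \<omega>)) \<partial>M n"
    and "E_time \<equiv> \<lambda>n. \<integral>\<^sup>+\<omega>. traversal_time (\<lambda>t. (A n t \<omega>, B n t \<omega>)) \<partial>M n"
  shows "(\<forall>n\<ge>1. E_area n < \<infinity> \<and> E_area n = (\<Sum>m=1..n. of_nat m * E_time m)) \<and>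
         (\<forall>\<delta>::real. \<delta> > 0 \<longrightarrow>
            (\<lambda>n. enn2real (\<Sum>m=1..n. of_nat m * E_time m) - pi * (real n)\<^sup>2 / 4)
              \<in> O(\<lambda>n. real n powr (3/2 + \<delta>)))"
proof -
  let ?t = "\<lambda>a b. 1 / real (a + b)" and ?s = "\<lambda>a b. (real a)\<^sup>2 / real (a + b)"
  define F where "F = urn_limit ?t"
  define G where "G = urn_limit ?s"
  have t: "0 \<le> ?t a b" "?t a b \<le> real (max 1 a)" for a b
    using time_reward_le by simp_all
  have s: "0 \<le> ?s a b" "?s a b \<le> real (max 1 a)" for a b
    using area_reward_le by simp_all
  have proc: "urn_process (M n) (\<lambda>t \<omega>. (A n t \<omega>, B n t \<omega>)) n" if "n \<ge> 1" for n
    using fast[OF that] that by unfold_locales (auto simp: fast_embedding_def)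
  have time: "E_time n = ennreal (F n 0)" if "n \<ge> 1" for n
    unfolding E_time_def F_def using urn_process.expected_time[OF proc[OF that]] by simp
  have area: "E_area n = ennreal (G n 0)" if "n \<ge> 1" for n
    unfolding E_area_def G_def using urn_process.expected_area[OF proc[OF that]] by simp
  have F_nonneg: "0 \<le> F a b" for a b
    unfolding F_def by (rule LIMSEQ_le_const[OF urn_value_tendsto[OF t]])
      (use urn_value_nonneg[OF t] in auto)
  have F0: "F 0 b = 0" for b unfolding F_def by (rule urn_limit_0[OF t])
  have F_gen: "urn_gen F a b = -1" if "a \<ge> 1" for a b
    unfolding F_def urn_gen_limit[OF t that] using that by simp
  have F_bdd: "\<exists>C. \<forall>b\<ge>1. \<bar>F a b\<bar> \<le> C" for a
    unfolding F_def by (rule urn_limit_bounded[OF t])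
  have G0: "G 0 b = 0" for b unfolding G_def by (rule urn_limit_0[OF s])
  have G_gen: "urn_gen G a b = - (real a)\<^sup>2" if "a \<ge> 1" for a b
    unfolding G_def urn_gen_limit[OF s that] using that by simp
  have G_bdd: "\<exists>C. \<forall>b\<ge>1. \<bar>G a b\<bar> \<le> C" for a
    unfolding G_def by (rule urn_limit_bounded[OF s])
  have sum: "(\<Sum>m=1..n. of_nat m * E_time m) = ennreal (\<Sum>m=1..n. real m * F m 0)" for n
  proof -
    have "(\<Sum>m=1..n. of_nat m * E_time m) = (\<Sum>m=1..n. ennreal (real m * F m 0))"
      using F_nonneg by (intro sum.cong refl) (simp add: time ennreal_mult ennreal_of_nat_eq_real_of_nat)
    also have "\<dots> = ennreal (\<Sum>m=1..n. real m * F m 0)"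
      using F_nonneg by (intro sum_ennreal) auto
    finally show ?thesis .
  qed
  have "E_area n < \<infinity> \<and> E_area n = (\<Sum>m=1..n. of_nat m * E_time m)" if "n \<ge> 1" for n
  proof -
    have "G n 0 = (\<Sum>m=1..n. real m * F m 0)"
      by (rule area_solution_eq_sum_time_solution[OF F0 G0 F_gen G_gen F_bdd G_bdd])
    then show ?thesis unfolding sum area[OF that] by simp
  qed
  moreover have "(\<lambda>n. enn2real (\<Sum>m=1..n. of_nat m * E_time m) - pi * (real n)\<^sup>2 / 4)
      \<in> O(\<lambda>n. real n powr (3/2 + \<delta>))" if "\<delta> > 0" for \<delta> :: real
  proof (rule bigoI[where c = 100003], rule eventually_sequentiallyI[where c = 1])
    fix n :: nat assume n: "1 \<le> n"
    have "enn2real (\<Sum>m=1..n. of_nat m * E_time m) = (\<Sum>m=1..n. real m * F m 0)"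
      unfolding sum using F_nonneg by (intro enn2real_ennreal sum_nonneg) auto
    then have "norm (enn2real (\<Sum>m=1..n. of_nat m * E_time m) - pi * (real n)\<^sup>2 / 4) \<le> 100003 * real n"
      using sum_time_solution_asymptotics[OF F0 F_gen F_bdd] by simp
    also have "real n = real n powr 1" using n by simp
    \<comment> \<open>The linear error suffices since 1 <= 3/2 + \<delta>.\<close>
    also have "real n powr 1 \<le> real n powr (3/2 + \<delta>)" using n that by (intro powr_mono) auto
    finally show "norm (enn2real (\<Sum>m=1..n. of_nat m * E_time m) - pi * (real n)\<^sup>2 / 4)
        \<le> 100003 * norm (real n powr (3/2 + \<delta>))" by simp
  qed
  ultimately show ?thesis by blast
qed

end
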